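(* Let $G$ and $H$ be graphs such that $m(G) \leq m_2(H)$ and $H$ is strictly $2$-balanced with at least $4$ vertices. Then Breaker has a winning strategy for the $H$-game on the edge set of $G$.
   Context: For a graph $G$, $m(G) := \max_{G' \subseteq G} e(G')/v(G')$ over nonempty subgraphs. For a graph with at least three vertices, $d_2(G) := (e_G - 1)/(v_G - 2)$ and $m_2(G) := \max\{d_2(J) : J \subseteq G, v_J \geq 3\}$; $G$ is strictly $2$-balanced if $m_2(G)=d_2(G)$ and $d_2(J) < m_2(G)$ for every proper subgraph $J$ with $v_J\ge 3$. In the $H$-game on $G$, Maker and Breaker alternately claim previously unclaimed edges of $G$, Maker moving first, until all edges are claimed; Maker wins if his edges contain all edges of a copy of $H$, Breaker wins otherwise.
   Formalization: H is additionally assumed not to be two disjoint edges on four vertices: that graph is strictly 2-balanced with m_2 = 1/2, yet Maker wins the game on three disjoint edges, where m(G) = 1/2. *)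

theory Defs
  imports Complex_Main
begin

type_synonym 'a ugraph = "'a set \<times> 'a set set"

abbreviation verts :: "'a ugraph \<Rightarrow> 'a set" where
  "verts G \<equiv> fst G"

abbreviation edges :: "'a ugraph \<Rightarrow> 'a set set" where
  "edges G \<equiv> snd G"

definition graph :: "'a ugraph \<Rightarrow> bool" where
  "graph G \<longleftrightarrow> finite (verts G) \<and> edges G \<subseteq> {e. e \<subseteq> verts G \<and> card e = 2}"

definition subgraph :: "'a ugraph \<Rightarrow> 'a ugraph \<Rightarrow> bool" where
  "subgraph J G \<longleftrightarrow> graph J \<and> verts J \<subseteq> verts G \<and> edges J \<subseteq> edges G"

(* For a graph without vertices the maximum ranges over the empty set and its value is
   unspecified. *)
definition max_density :: "'a ugraph \<Rightarrow> real" where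
  "max_density G =
     Max {real (card (edges J)) / real (card (verts J)) | J. subgraph J G \<and> verts J \<noteq> {}}"

definition d2 :: "'a ugraph \<Rightarrow> real" where
  "d2 G = (real (card (edges G)) - 1) / (real (card (verts G)) - 2)"

definition m2 :: "'a ugraph \<Rightarrow> real" where
  "m2 G = Max {d2 J | J. subgraph J G \<and> card (verts J) \<ge> 3}"

definition strictly_2_balanced :: "'a ugraph \<Rightarrow> bool" where
  "strictly_2_balanced G \<longleftrightarrow>
     card (verts G) \<ge> 3 \<and> m2 G = d2 G \<and>
     (\<forall>J. subgraph J G \<and> J \<noteq> G \<and> card (verts J) \<ge> 3 \<longrightarrow> d2 J < m2 G)"

(* The graph 2K_2. It is strictly 2-balanced with m2 = 1/2, and Maker wins the 2K_2-game on
   any matching with at least three edges, whose maximum density is also 1/2. *)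
definition two_disjoint_edges :: "'a ugraph \<Rightarrow> bool" where
  "two_disjoint_edges H \<longleftrightarrow>
     (\<exists>a b c d. distinct [a, b, c, d] \<and> H = ({a, b, c, d}, {{a, b}, {c, d}}))"

definition contains_copy :: "'a ugraph \<Rightarrow> 'b ugraph \<Rightarrow> bool" where
  "contains_copy G H \<longleftrightarrow>
     (\<exists>f. inj_on f (verts H) \<and> f ` verts H \<subseteq> verts G \<and> (\<forall>e\<in>edges H. f ` e \<in> edges G))"

(* A history is the list of edges claimed so far, in order; Maker makes the moves with even
   index, so it is Breaker's turn after a history of odd length. *)
definition history :: "'a ugraph \<Rightarrow> 'a set list \<Rightarrow> bool" where
  "history G h \<longleftrightarrow> distinct h \<and> set h \<subseteq> edges G"

definition complete_play :: "'a ugraph \<Rightarrow> 'a set list \<Rightarrow> bool" where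
  "complete_play G p \<longleftrightarrow> distinct p \<and> set p = edges G"

definition maker_edges :: "'a set list \<Rightarrow> 'a set set" where
  "maker_edges p = {p ! i | i. i < length p \<and> even i}"

(* A strategy has to answer every history that leaves an edge unclaimed with a legal move. *)
definition breaker_strategy :: "'a ugraph \<Rightarrow> ('a set list \<Rightarrow> 'a set) \<Rightarrow> bool" where
  "breaker_strategy G \<sigma> \<longleftrightarrow>
     (\<forall>h. history G h \<and> odd (length h) \<and> set h \<noteq> edges G \<longrightarrow> \<sigma> h \<in> edges G - set h)"

definition follows :: "('a set list \<Rightarrow> 'a set) \<Rightarrow> 'a set list \<Rightarrow> bool" where
  "follows \<sigma> p \<longleftrightarrow> (\<forall>i<length p. odd i \<longrightarrow> p ! i = \<sigma> (take i p))"

definition maker_wins_play :: "'b ugraph \<Rightarrow> 'a ugraph \<Rightarrow> 'a set list \<Rightarrow> bool" where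
  "maker_wins_play H G p \<longleftrightarrow> contains_copy (verts G, maker_edges p) H"

definition breaker_wins_game :: "'b ugraph \<Rightarrow> 'a ugraph \<Rightarrow> bool" where
  "breaker_wins_game H G \<longleftrightarrow>
     (\<exists>\<sigma>. breaker_strategy G \<sigma> \<and>
        (\<forall>p. complete_play G p \<and> follows \<sigma> p \<longrightarrow> \<not> maker_wins_play H G p))"

end

theory Submission
  imports Defs
begin

text \<open>Write \<open>n = v\<^sub>H - 2\<close>, \<open>m = e\<^sub>H - 1\<close> and \<open>k = \<lfloor>m / n\<rfloor>\<close>, so that \<open>m\<^sub>2(H) = m / n\<close>. Deleting a
  vertex from \<open>H\<close> shows that \<open>H\<close> has minimum degree at least \<open>k + 1\<close>, while every \<open>U \<subseteq> V(G)\<close> spans at most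
  \<open>(m / n) |U|\<close> edges of \<open>G\<close>. If \<open>m / n < k + 1/2\<close>, then \<open>G\<close> is \<open>2k\<close>-degenerate, and by answering at the
  same vertex Breaker keeps Maker's graph \<open>k\<close>-degenerate. Otherwise \<open>G\<close> can be oriented with out-degrees
  at most \<open>k + 1\<close>, and Breaker halves every out-neighbourhood; this makes Maker's graph too sparse
  to contain \<open>H\<close> unless \<open>(v\<^sub>H, e\<^sub>H)\<close> is one of seven pairs.

  If \<open>e\<^sub>H = 2 v\<^sub>H\<close>, the orientation can be refined. For the remaining pairs one may delete vertices of
  degree at most \<open>2k\<close> first. The pair \<open>(5, 9)\<close> is settled by two adjacent vertices of degree 5;
  for \<open>(4, 6)\<close> and \<open>(6, 11)\<close> the remaining graph is 5-regular, and hence 4-degenerate after the removal of one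
  vertex per component; for \<open>(4, 4)\<close> it is cubic, and Breaker's first reply in a component makes the rest
  2-degenerate once Maker's first edge is contracted.\<close>

text \<open>Breaker's main tool is to cut the board into groups and to reply in the group that Maker
  has just used; Maker moves first in each group and may get half of it, rounded up. This rounding
  is the obstacle. Out-degree k + 1 leaves Maker (k + 1)/2 edges per vertex, rounded up: nothing is
  lost for odd k, half an edge per vertex for even k, and only for small k and v_H does e_H fail to
  exceed the resulting bound. The same loss occurs at the vertex removed from a regular component.
  Removing a vertex of degree 5 gives Maker at most 3 edges there and 2w - 3 edges on w >= 2 other
  vertices: 3 + 7 < 11 settles (6, 11), but 3 + 3 = 6 is exactly tight for (4, 6). For degree 3 and
  a forest on the rest, 2 + 2 = 4 is tight for (4, 4). These two cases therefore need the structure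
  of the component: triangles on an edge in one, bridges in the other. Where degeneracy is
  available, it comes from the average degree 2 m / n < 2k + 1 of every vertex set. Excluding two
  disjoint edges ensures m >= n, that is k >= 1.\<close>

subsection \<open>Positional games\<close>

text \<open>Maker is to move, owns \<open>M\<close>, and \<open>E\<close> is the set of free edges. Breaker's reply \<open>b\<close> need not be
  free, so Breaker may pass; this is harmless since \<open>P\<close> only constrains Maker's edges.\<close>
inductive breaker_forces :: "('e set \<Rightarrow> bool) \<Rightarrow> 'e set \<Rightarrow> 'e set \<Rightarrow> bool" for P where
  breaker_forcesI: "P M \<Longrightarrow> (\<And>f. f \<in> E \<Longrightarrow> \<exists>b. breaker_forces P (insert f M) (E - {f, b}))
    \<Longrightarrow> breaker_forces P M E"

lemma breaker_forces_now: "breaker_forces P M E \<Longrightarrow> P M"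
  by (auto elim: breaker_forces.cases)

lemma breaker_forces_step:
  "breaker_forces P M E \<Longrightarrow> f \<in> E \<Longrightarrow> \<exists>b. breaker_forces P (insert f M) (E - {f, b})"
  by (erule breaker_forces.cases) simp

text \<open>Breaker keeps his replies; one that has dropped out of the board becomes a pass.\<close>

lemma breaker_forces_subset:
  assumes "breaker_forces P M E" "E' \<subseteq> E"
  shows "breaker_forces P M E'"
  using assms
proof (induction arbitrary: E')
  case (breaker_forcesI M E)
  show ?case
  proof (rule breaker_forces.breaker_forcesI)
    show "P M" by fact
    fix f assume "f \<in> E'"
    with breaker_forcesI obtain b where
      b: "\<And>E''. E'' \<subseteq> E - {f, b} \<Longrightarrow> breaker_forces P (insert f M) E''"
      by blast
    have "breaker_forces P (insert f M) (E' - {f, b})"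
      using breaker_forcesI.prems by (intro b) auto
    then show "\<exists>b. breaker_forces P (insert f M) (E' - {f, b})" ..
  qed
qed

lemma breaker_forces_mono:
  assumes "breaker_forces P M E" "\<And>M. P M \<Longrightarrow> Q M"
  shows "breaker_forces Q M E"
  using assms
proof (induction)
  case (breaker_forcesI M E)
  then show ?case by (intro breaker_forces.breaker_forcesI) blast+
qed

text \<open>Breaker answers on the board on which Maker has just played, so each board sees an
  ordinary alternating game; hence the nested induction. The boards may overlap: a common edge is
  played on the first, and its disappearance merely shrinks the second.\<close>

lemma breaker_forces_union:
  assumes "breaker_forces P1 M1 E1" "breaker_forces P2 M2 E2"
    and "\<And>M1 M2. P1 M1 \<Longrightarrow> P2 M2 \<Longrightarrow> P (M1 \<union> M2)"
  shows "breaker_forces P (M1 \<union> M2) (E1 \<union> E2)"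
  using assms(1,2)
proof (induction arbitrary: M2 E2)
  case outer: (breaker_forcesI M1 E1)
  from outer.prems show ?case
  proof (induction)
    case inner: (breaker_forcesI M2 E2)
    show ?case
    proof (rule breaker_forces.breaker_forcesI)
      show "P (M1 \<union> M2)" using assms(3) outer inner by blast
      fix f assume f: "f \<in> E1 \<union> E2"
      show "\<exists>b. breaker_forces P (insert f (M1 \<union> M2)) ((E1 \<union> E2) - {f, b})"
      proof (cases "f \<in> E1")
        case True
        have *: "breaker_forces P2 M2 E2"
          using inner by (intro breaker_forces.breaker_forcesI) blast+
        from outer.IH[OF True] * obtain b where
          "breaker_forces P (insert f M1 \<union> M2) ((E1 - {f, b}) \<union> E2)" by blast
        then have "breaker_forces P (insert f M1 \<union> M2) ((E1 \<union> E2) - {f, b})"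
          by (rule breaker_forces_subset) auto
        then show ?thesis by auto
      next
        case False
        with f inner obtain b where
          "breaker_forces P (M1 \<union> insert f M2) (E1 \<union> (E2 - {f, b}))" by blast
        then have "breaker_forces P (M1 \<union> insert f M2) ((E1 \<union> E2) - {f, b})"
          by (rule breaker_forces_subset) auto
        then show ?thesis by auto
      qed
    qed
  qed
qed

lemma breaker_forces_split:
  assumes "breaker_forces P1 {} E1" "breaker_forces P2 {} E2" "E \<subseteq> E1 \<union> E2"
    and "\<And>M1 M2. P1 M1 \<Longrightarrow> P2 M2 \<Longrightarrow> P (M1 \<union> M2)"
  shows "breaker_forces P {} E"
  using breaker_forces_subset[OF breaker_forces_union[OF assms(1,2), of P] assms(3)] assms(4)
  by simp

text \<open>The invariant of replying in the same group: while a group has free edges, Breaker has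
  removed at least as many of its edges as Maker has taken. The second alternative arises when Maker
  takes the last free edge of a group, and it is the source of the \<open>+ 1\<close>.\<close>

lemma breaker_forces_groups_aux:
  fixes g :: "'e \<Rightarrow> 'i"
  assumes "finite R" "finite M" "M \<inter> R = {}" "M \<union> R \<subseteq> E"
    and "\<And>i. 2 * card {e\<in>M. g e = i} + card {e\<in>R. g e = i} \<le> card {e\<in>E. g e = i}
      \<or> {e\<in>R. g e = i} = {} \<and> 2 * card {e\<in>M. g e = i} \<le> card {e\<in>E. g e = i} + 1"
  shows "breaker_forces (\<lambda>M. M \<subseteq> E \<and> (\<forall>i. 2 * card {e\<in>M. g e = i} \<le> card {e\<in>E. g e = i} + 1)) M R"
  using assms
proof (induction "card R" arbitrary: M R rule: less_induct)
  case less
  show ?case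
  proof (rule breaker_forces.breaker_forcesI)
    show "M \<subseteq> E \<and> (\<forall>i. 2 * card {e\<in>M. g e = i} \<le> card {e\<in>E. g e = i} + 1)"
    proof (intro conjI allI)
      show "M \<subseteq> E" using less.prems by auto
      fix i show "2 * card {e\<in>M. g e = i} \<le> card {e\<in>E. g e = i} + 1"
        using less.prems(5)[of i] by linarith
    qed
    fix f assume f: "f \<in> R"
    define i where "i = g f"
    \<comment> \<open>When \<open>f\<close> was the last free edge of its group, the reply is
      \<open>f\<close> itself, that is, a pass.\<close>
    obtain b where b: "b \<in> R" "g b = i" and bf: "(\<exists>b\<in>R - {f}. g b = i) \<Longrightarrow> b \<noteq> f"
    proof (cases "\<exists>b\<in>R - {f}. g b = i")
      case True then show ?thesis using that by blast
    next
      case False then show ?thesis using that[of f] f i_def by blast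
    qed
    have Mi: "{e \<in> insert f M. g e = j} = (if j = i then insert f {e\<in>M. g e = i} else {e\<in>M. g e = j})" for j
      by (auto simp: i_def)
    have fM: "f \<notin> M" using f less.prems by auto
    have Ri: "{e \<in> R - {f, b}. g e = j} = (if j = i then {e\<in>R. g e = i} - {f, b} else {e\<in>R. g e = j})" for j
      using b by (auto simp: i_def)
    have fin: "finite {e\<in>R. g e = i}" "finite {e\<in>M. g e = i}" using less.prems by auto
    have cM: "card (insert f {e\<in>M. g e = i}) = Suc (card {e\<in>M. g e = i})"
      using fM fin by simp
    have "f \<in> {e\<in>R. g e = i}" using f by (simp add: i_def)
    then have old: "2 * card {e\<in>M. g e = i} + card {e\<in>R. g e = i} \<le> card {e\<in>E. g e = i}"
      using less.prems(5)[of i] by blast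
    have new: "2 * card {e \<in> insert f M. g e = i} + card {e \<in> R - {f, b}. g e = i} \<le> card {e\<in>E. g e = i}
      \<or> {e \<in> R - {f, b}. g e = i} = {} \<and> 2 * card {e \<in> insert f M. g e = i} \<le> card {e\<in>E. g e = i} + 1"
    proof (cases "\<exists>b\<in>R - {f}. g b = i")
      case True
      then have "b \<noteq> f" by (rule bf)
      then have "card ({e\<in>R. g e = i} - {f, b}) + 2 = card {e\<in>R. g e = i}"
        using b f fin card_Diff_subset[of "{f, b}" "{e\<in>R. g e = i}"]
          card_mono[of "{e\<in>R. g e = i}" "{f, b}"] by (auto simp: i_def)
      then show ?thesis using old cM unfolding Mi Ri by simp
    next
      case False
      then have "{e\<in>R. g e = i} = {f}" using f by (auto simp: i_def)
      then show ?thesis using old cM unfolding Mi Ri by auto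
    qed
    have "breaker_forces (\<lambda>M. M \<subseteq> E \<and> (\<forall>i. 2 * card {e\<in>M. g e = i} \<le> card {e\<in>E. g e = i} + 1))
      (insert f M) (R - {f, b})"
    proof (rule less.hyps)
      show "card (R - {f, b}) < card R" using f less.prems by (intro psubset_card_mono) auto
      show "finite (R - {f, b})" "finite (insert f M)" "insert f M \<inter> (R - {f, b}) = {}"
        "insert f M \<union> (R - {f, b}) \<subseteq> E" using less.prems f by auto
      fix j show "2 * card {e \<in> insert f M. g e = j} + card {e \<in> R - {f, b}. g e = j} \<le> card {e\<in>E. g e = j}
        \<or> {e \<in> R - {f, b}. g e = j} = {} \<and> 2 * card {e \<in> insert f M. g e = j} \<le> card {e\<in>E. g e = j} + 1"
      proof (cases "j = i")
        case True then show ?thesis using new by simp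
      next
        case False then show ?thesis using less.prems(5)[of j] unfolding Mi Ri by simp
      qed
    qed
    then show "\<exists>b. breaker_forces (\<lambda>M. M \<subseteq> E \<and> (\<forall>i. 2 * card {e\<in>M. g e = i} \<le> card {e\<in>E. g e = i} + 1))
      (insert f M) (R - {f, b})" ..
  qed
qed

text \<open>Halving, pairing and the oriented strategies are all instances, for different labellings
  \<open>g\<close>.\<close>

lemma breaker_forces_groups:
  assumes "finite E"
  shows "breaker_forces (\<lambda>M. M \<subseteq> E \<and> (\<forall>i. 2 * card {e\<in>M. g e = i} \<le> card {e\<in>E. g e = i} + 1)) {} E"
  using assms by (intro breaker_forces_groups_aux) auto

section \<open>From forced positions to strategies on histories\<close>

lemma maker_edges_snoc:
  "maker_edges (h @ [x]) = (if even (length h) then insert x (maker_edges h) else maker_edges h)"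
proof -
  have "maker_edges p = (\<lambda>i. p ! i) ` {i. i < length p \<and> even i}" for p :: "'a set list"
    unfolding maker_edges_def by blast
  moreover have "{i. i < length (h @ [x]) \<and> even i}
      = {i. i < length h \<and> even i} \<union> (if even (length h) then {length h} else {})"
    by (auto simp: less_Suc_eq)
  ultimately show ?thesis by (auto simp: image_Un nth_append intro!: image_cong)
qed

text \<open>Passes are made legal here: instead of passing, Breaker claims any free edge, which only
  shrinks Maker's board.\<close>

lemma breaker_forces_imp_strategy:
  assumes "finite (edges G)" "breaker_forces P {} (edges G)"
  obtains \<sigma> where "breaker_strategy G \<sigma>"
    "\<And>p. complete_play G p \<Longrightarrow> follows \<sigma> p \<Longrightarrow> P (maker_edges p)"
proof -
  define good where "good h b \<longleftrightarrow> b \<in> edges G - set h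
    \<and> breaker_forces P (maker_edges h) (edges G - set h - {b})" for h b
  \<comment> \<open>The second branch matters because legality is demanded for every history,
    including those in which \<open>\<sigma>\<close> was not followed and no good reply need
    exist.\<close>
  define \<sigma> where "\<sigma> h = (if \<exists>b. good h b then SOME b. good h b else SOME b. b \<in> edges G - set h)" for h
  have \<sigma>_good: "good h (\<sigma> h)" if "\<exists>b. good h b" for h
    using that someI_ex[of "good h"] by (simp add: \<sigma>_def)
  have legal: "\<sigma> h \<in> edges G - set h" if "history G h" "set h \<noteq> edges G" for h
  proof (cases "\<exists>b. good h b")
    case True then show ?thesis using \<sigma>_good[OF True] by (simp add: good_def)
  next
    case False
    have "\<exists>b. b \<in> edges G - set h" using that by (auto simp: history_def)
    from someI_ex[OF this] False show ?thesis by (simp add: \<sigma>_def)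
  qed
  \<comment> \<open>At odd length the reply \<open>b\<close> that the game provides is still
    owed.\<close>
  have inv: "(even (length h) \<longrightarrow> breaker_forces P (maker_edges h) (edges G - set h)) \<and>
      (odd (length h) \<longrightarrow> (\<exists>b. breaker_forces P (maker_edges h) (edges G - set h - {b})))"
    if "history G h" "follows \<sigma> h" for h
    using that
  proof (induction h rule: rev_induct)
    case Nil
    then show ?case using assms by (simp add: maker_edges_def)
  next
    case (snoc x h)
    have hist: "history G h" "x \<in> edges G - set h" using snoc.prems by (auto simp: history_def)
    have fol: "follows \<sigma> h" unfolding follows_def
    proof (intro allI impI)
      fix i assume i: "i < length h" "odd i"
      then have "(h @ [x]) ! i = \<sigma> (take i (h @ [x]))"
        using snoc.prems(2) unfolding follows_def by simp
      then show "h ! i = \<sigma> (take i h)" using i by (simp add: nth_append)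
    qed
    note IH = snoc.IH[OF hist(1) fol]
    have set: "edges G - set (h @ [x]) = edges G - set h - {x}" by auto
    show ?case
    proof (cases "even (length h)")
      case True
      then have "breaker_forces P (maker_edges h) (edges G - set h)" using IH by simp
      from breaker_forces_step[OF this hist(2)]
      obtain b where "breaker_forces P (insert x (maker_edges h)) (edges G - set h - {x, b})" ..
      moreover have "edges G - set h - {x, b} = edges G - set h - {x} - {b}" by auto
      ultimately have "breaker_forces P (insert x (maker_edges h)) (edges G - set h - {x} - {b})" by simp
      then show ?thesis using True unfolding maker_edges_snoc set by auto
    next
      case False
      then obtain b where b: "breaker_forces P (maker_edges h) (edges G - set h - {b})" using IH by auto
      have "\<exists>b'. good h b'"
      proof (cases "b \<in> edges G - set h")
        case True then show ?thesis using b by (auto simp: good_def)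
      next
        case False
        then have "breaker_forces P (maker_edges h) (edges G - set h)" using b by simp
        then have "breaker_forces P (maker_edges h) (edges G - set h - {x})"
          by (rule breaker_forces_subset) auto
        then have "good h x" using hist(2) by (simp add: good_def)
        then show ?thesis ..
      qed
      then have "good h (\<sigma> h)" by (rule \<sigma>_good)
      moreover have "(h @ [x]) ! length h = \<sigma> (take (length h) (h @ [x]))"
        using snoc.prems(2) False unfolding follows_def by (metis length_append_singleton lessI)
      ultimately have "good h x" by simp
      then show ?thesis using False unfolding maker_edges_snoc set good_def by simp
    qed
  qed
  show ?thesis
  proof
    show "breaker_strategy G \<sigma>" using legal by (auto simp: breaker_strategy_def)
    fix p assume "complete_play G p" "follows \<sigma> p"
    then have "history G p" by (auto simp: complete_play_def history_def)
    from inv[OF this \<open>follows \<sigma> p\<close>] show "P (maker_edges p)"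
      by (cases "even (length p)") (auto dest: breaker_forces_now)
  qed
qed

subsection \<open>Graphs as sets of edges\<close>

definition inner :: "'a set set \<Rightarrow> 'a set \<Rightarrow> 'a set set" where
  "inner E U = {e\<in>E. e \<subseteq> U}"

definition incident :: "'a set set \<Rightarrow> 'a \<Rightarrow> 'a set set" where
  "incident E x = {e\<in>E. x \<in> e}"

definition two_sets :: "'a set set \<Rightarrow> bool" where
  "two_sets E \<longleftrightarrow> (\<forall>e\<in>E. card e = 2)"

lemma two_sets_subset: "two_sets E \<Longrightarrow> F \<subseteq> E \<Longrightarrow> two_sets F"
  by (auto simp: two_sets_def)

lemma inner_subset: "inner E U \<subseteq> E" by (auto simp: inner_def)

lemma two_sets_inner: "two_sets E \<Longrightarrow> two_sets (inner E U)"
  by (auto simp: two_sets_def inner_def)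

lemma finite_inner: "finite U \<Longrightarrow> finite (inner E U)"
  by (rule finite_subset[of _ "Pow U"]) (auto simp: inner_def)

lemma finite_incident: "finite E \<Longrightarrow> finite (incident E x)"
  by (auto simp: incident_def)

lemma card_inner_le_choose:
  assumes "finite U" "two_sets E"
  shows "card (inner E U) \<le> card U choose 2"
proof -
  have "inner E U \<subseteq> {B. B \<subseteq> U \<and> card B = 2}" using assms by (auto simp: inner_def two_sets_def)
  then have "card (inner E U) \<le> card {B. B \<subseteq> U \<and> card B = 2}"
    using assms by (intro card_mono) (auto intro: finite_subset[of _ "Pow U"])
  then show ?thesis using n_subsets[OF assms(1), of 2] by simp
qed

lemma handshake:
  assumes "finite U" "two_sets E"
  shows "(\<Sum>x\<in>U. card (incident (inner E U) x)) = 2 * card (inner E U)"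
proof -
  have fin: "finite (inner E U)" using assms finite_inner by blast
  have "(\<Sum>x\<in>U. card (incident (inner E U) x)) = (\<Sum>x\<in>U. \<Sum>e\<in>inner E U. if x \<in> e then 1 else 0)"
    using fin by (simp add: incident_def sum.If_cases Int_def)
  also have "\<dots> = (\<Sum>e\<in>inner E U. \<Sum>x\<in>U. if x \<in> e then 1 else 0)" by (rule sum.swap)
  also have "\<dots> = (\<Sum>e\<in>inner E U. 2)"
  proof (rule sum.cong)
    fix e assume e: "e \<in> inner E U"
    then have "U \<inter> {x. x \<in> e} = e" "card e = 2" using assms by (auto simp: inner_def two_sets_def)
    then show "(\<Sum>x\<in>U. if x \<in> e then 1 else 0) = (2::nat)" using assms by (simp add: sum.If_cases)
  qed simp
  finally show ?thesis by simp
qed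

lemma inner_remove_vertex:
  "x \<in> U \<Longrightarrow> inner E U = inner E (U - {x}) \<union> incident (inner E U) x"
  by (auto simp: inner_def incident_def)

lemma card_inner_remove_vertex:
  assumes "finite U" "x \<in> U"
  shows "card (inner E U) = card (inner E (U - {x})) + card (incident (inner E U) x)"
proof -
  have "inner E (U - {x}) \<inter> incident (inner E U) x = {}" by (auto simp: inner_def incident_def)
  then have "card (inner E (U - {x}) \<union> incident (inner E U) x)
     = card (inner E (U - {x})) + card (incident (inner E U) x)"
    using assms by (intro card_Un_disjoint) (auto intro!: finite_inner finite_incident)
  then show ?thesis using inner_remove_vertex[OF assms(2), of E] by simp
qed

lemma two_set_cases:
  assumes "card e = 2" "x \<in> e"
  obtains y where "e = {x, y}" "y \<noteq> x"
  using assms by (auto simp: card_2_iff)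

lemma two_sets_eq: "two_sets E \<Longrightarrow> e \<in> E \<Longrightarrow> x \<in> e \<Longrightarrow> y \<in> e \<Longrightarrow> x \<noteq> y \<Longrightarrow> e = {x, y}"
  by (auto simp: two_sets_def card_2_iff)

definition nbrs :: "'a set set \<Rightarrow> 'a \<Rightarrow> 'a set" where
  "nbrs E x = {y. {x, y} \<in> E}"

lemma nbrs_sym: "y \<in> nbrs E x \<longleftrightarrow> x \<in> nbrs E y"
  by (simp add: nbrs_def insert_commute)

lemma nbrs_irrefl: "two_sets E \<Longrightarrow> x \<notin> nbrs E x"
  by (force simp: nbrs_def two_sets_def)

lemma incident_eq_nbrs:
  assumes "two_sets E"
  shows "incident E x = (\<lambda>y. {x, y}) ` nbrs E x"
proof (intro equalityI subsetI)
  fix e assume e: "e \<in> incident E x"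
  then have "card e = 2" "x \<in> e" "e \<in> E" using assms by (auto simp: incident_def two_sets_def)
  then obtain y where "e = {x, y}" by (meson two_set_cases)
  then show "e \<in> (\<lambda>y. {x, y}) ` nbrs E x" using \<open>e \<in> E\<close> by (auto simp: nbrs_def)
qed (auto simp: incident_def nbrs_def)

lemma card_incident_eq_nbrs:
  assumes "two_sets E"
  shows "card (incident E x) = card (nbrs E x)"
proof -
  have "inj_on (\<lambda>y. {x, y}) (nbrs E x)" by (auto simp: inj_on_def doubleton_eq_iff)
  then show ?thesis using incident_eq_nbrs[OF assms] card_image by metis
qed

lemma card_incident_less:
  assumes "two_sets E" "finite U" "x \<in> U"
  shows "card (incident (inner E U) x) < card U"
proof -
  have "nbrs (inner E U) x \<subseteq> U - {x}"
    using nbrs_irrefl[OF two_sets_inner[OF assms(1)], of x U] by (auto simp: nbrs_def inner_def)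
  then have "card (nbrs (inner E U) x) \<le> card (U - {x})" using assms by (intro card_mono) auto
  then show ?thesis using assms card_incident_eq_nbrs[OF two_sets_inner[OF assms(1)]] card_Diff1_less
    by (metis le_less_trans)
qed

text \<open>Peeling off vertices of degree at most \<open>j\<close> until \<open>j\<close> vertices
  remain removes at most j (|W| - j) edges, and the last \<open>j\<close> vertices span at most
  \<open>j choose 2\<close>. The difference to j |W| is \<open>Suc j choose 2\<close>.\<close>

lemma degenerate_card_inner:
  assumes "two_sets M" "finite W" "j \<le> card W"
    and "\<And>W'. W' \<subseteq> W \<Longrightarrow> W' \<noteq> {} \<Longrightarrow> \<exists>w\<in>W'. card (incident (inner M W') w) \<le> j"
  shows "card (inner M W) + (Suc j choose 2) \<le> j * card W"
  using assms(2-)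
proof (induction "card W" arbitrary: W)
  case 0
  then have "inner M W = {}" using assms(1) by (auto simp: inner_def two_sets_def)
  then show ?case using 0 by simp
next
  case (Suc c)
  show ?case
  proof (cases "card W = j")
    case True
    have "card (inner M W) \<le> j choose 2" using card_inner_le_choose[OF Suc.prems(1) assms(1)] True by simp
    moreover have "(j choose 2) + (Suc j choose 2) = j * j"
      by (induction j) (auto simp: numeral_2_eq_2)
    ultimately show ?thesis using True by simp
  next
    case False
    have "W \<noteq> {}" using Suc.hyps by auto
    then obtain w where w: "w \<in> W" "card (incident (inner M W) w) \<le> j" using Suc.prems(3) by blast
    have cW: "card W = Suc (card (W - {w}))" using w Suc.prems by (metis card_Suc_Diff1)
    have "card (inner M (W - {w})) + (Suc j choose 2) \<le> j * card (W - {w})"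
    proof (rule Suc.hyps(1))
      show "c = card (W - {w})" using cW Suc.hyps by simp
      show "j \<le> card (W - {w})" using cW Suc.prems False by simp
      show "finite (W - {w})" using Suc.prems by simp
      fix W' assume "W' \<subseteq> W - {w}" "W' \<noteq> {}"
      then show "\<exists>w\<in>W'. card (incident (inner M W') w) \<le> j" by (intro Suc.prems(3)) auto
    qed
    then show ?thesis using card_inner_remove_vertex[OF Suc.prems(1) w(1), of M] w(2) cW by simp
  qed
qed

lemma breaker_forces_half:
  assumes "finite E" "card E \<le> 2 * j"
  shows "breaker_forces (\<lambda>M. M \<subseteq> E \<and> card M \<le> j) {} E"
proof (rule breaker_forces_mono[OF breaker_forces_groups[OF assms(1), of "\<lambda>_. ()"]])
  fix M assume "M \<subseteq> E \<and> (\<forall>i. 2 * card {e\<in>M. () = i} \<le> card {e\<in>E. () = i} + 1)"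
  then show "M \<subseteq> E \<and> card M \<le> j" using assms(2) by auto
qed

lemma breaker_forces_any: "breaker_forces (\<lambda>M. M \<subseteq> E) {} E" if "finite E"
  by (rule breaker_forces_mono[OF breaker_forces_half[OF that, of "card E"]]) auto

text \<open>Vertices of degree at most \<open>2 * j\<close> are eliminated one by one, and Breaker
  halves the edges from each to the vertices still present. In any \<open>W\<close>, the vertex
  eliminated first then has at most \<open>j\<close> of Maker's edges.\<close>

lemma breaker_forces_degenerate:
  assumes "two_sets E" "finite U"
    and "\<And>U'. U' \<subseteq> U \<Longrightarrow> U' \<noteq> {} \<Longrightarrow> \<exists>x\<in>U'. card (incident (inner E U') x) \<le> 2 * j"
  shows "breaker_forces (\<lambda>M. M \<subseteq> inner E U \<and>
    (\<forall>W\<subseteq>U. W \<noteq> {} \<longrightarrow> (\<exists>w\<in>W. card (incident (inner M W) w) \<le> j))) {} (inner E U)"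
  using assms(2,3)
proof (induction rule: finite_psubset_induct)
  case (psubset U)
  show ?case
  proof (cases "U = {}")
    case True
    then have "inner E U = {}" using assms(1) by (auto simp: inner_def two_sets_def)
    then show ?thesis using True by (auto intro: breaker_forces.breaker_forcesI)
  next
    case False
    then obtain x where x: "x \<in> U" "card (incident (inner E U) x) \<le> 2 * j" using psubset.prems by blast
    have fin: "finite (incident (inner E U) x)" using psubset.hyps by (simp add: finite_inner finite_incident)
    note g1 = breaker_forces_half[OF fin x(2)]
    have "breaker_forces (\<lambda>M. M \<subseteq> inner E (U - {x}) \<and>
      (\<forall>W\<subseteq>U - {x}. W \<noteq> {} \<longrightarrow> (\<exists>w\<in>W. card (incident (inner M W) w) \<le> j))) {} (inner E (U - {x}))"
    proof (rule psubset.IH)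
      show "U - {x} \<subset> U" using x(1) by blast
      fix U' assume "U' \<subseteq> U - {x}" "U' \<noteq> {}"
      then show "\<exists>x\<in>U'. card (incident (inner E U') x) \<le> 2 * j" by (intro psubset.prems) blast+
    qed
    from g1 this show ?thesis
    proof (rule breaker_forces_split)
      show "inner E U \<subseteq> incident (inner E U) x \<union> inner E (U - {x})"
        using inner_remove_vertex[OF x(1)] by blast
      fix M1 M2 assume M1: "M1 \<subseteq> incident (inner E U) x \<and> card M1 \<le> j"
        and M2: "M2 \<subseteq> inner E (U - {x}) \<and>
          (\<forall>W\<subseteq>U - {x}. W \<noteq> {} \<longrightarrow> (\<exists>w\<in>W. card (incident (inner M2 W) w) \<le> j))"
      show "M1 \<union> M2 \<subseteq> inner E U \<and>
        (\<forall>W\<subseteq>U. W \<noteq> {} \<longrightarrow> (\<exists>w\<in>W. card (incident (inner (M1 \<union> M2) W) w) \<le> j))"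
      proof (intro conjI allI impI)
        show "M1 \<union> M2 \<subseteq> inner E U" using M1 M2 by (auto simp: incident_def inner_def)
        fix W assume W: "W \<subseteq> U" "W \<noteq> {}"
        show "\<exists>w\<in>W. card (incident (inner (M1 \<union> M2) W) w) \<le> j"
        proof (cases "x \<in> W")
          case True
          have "incident (inner (M1 \<union> M2) W) x \<subseteq> M1" using M2 by (auto simp: incident_def inner_def)
          then have "card (incident (inner (M1 \<union> M2) W) x) \<le> card M1"
            using M1 fin by (intro card_mono) (auto intro: finite_subset)
          then show ?thesis using True M1 by (intro bexI[of _ x]) auto
        next
          case False
          then have "inner (M1 \<union> M2) W = inner M2 W" using M1 by (auto simp: incident_def inner_def)
          moreover have "W \<subseteq> U - {x}" using False W by auto
          ultimately show ?thesis using W(2) conjunct2[OF M2] by (simp only:) blast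
        qed
      qed
    qed
  qed
qed

text \<open>Hall's theorem with \<open>c x\<close> places at \<open>x\<close>. If some nonempty
  proper \<open>F\<close> is tight, it uses up all places on its vertices, so it is solved alone and
  the rest is solved with these vertices closed. If none is tight, there is slack one everywhere, so
  one edge may be given to any endpoint that has a place left.\<close>

lemma hall_capacity:
  fixes c :: "'a \<Rightarrow> nat"
  assumes "finite E" "\<And>e. e \<in> E \<Longrightarrow> finite e"
    and "\<And>F. F \<subseteq> E \<Longrightarrow> card F \<le> (\<Sum>x\<in>\<Union>F. c x)"
  shows "\<exists>o'. (\<forall>e\<in>E. o' e \<in> e) \<and> (\<forall>x. card {e\<in>E. o' e = x} \<le> c x)"
  using assms
proof (induction "card E" arbitrary: E c rule: less_induct)
  case less
  have finU: "finite (\<Union>F)" if "F \<subseteq> E" for F using that less.prems(1,2) by (meson finite_Union finite_subset subsetD)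
  consider "E = {}" | F where "F \<subset> E" "F \<noteq> {}" "card F = (\<Sum>x\<in>\<Union>F. c x)"
    | "E \<noteq> {}" "\<And>F. F \<subset> E \<Longrightarrow> F \<noteq> {} \<Longrightarrow> card F < (\<Sum>x\<in>\<Union>F. c x)"
    using less.prems(3) by (metis order_less_le psubset_imp_subset)
  then show ?case
  proof cases
    case 1 then show ?thesis by simp
  next
    case (2 F)
    have "\<exists>o'. (\<forall>e\<in>F. o' e \<in> e) \<and> (\<forall>x. card {e\<in>F. o' e = x} \<le> c x)"
    proof (rule less.hyps)
      show "card F < card E" using 2 less.prems(1) by (intro psubset_card_mono)
      show "finite F" using 2 less.prems(1) by (auto intro: finite_subset)
    qed (use 2 less.prems in auto)
    then obtain o1 where o1: "\<And>e. e \<in> F \<Longrightarrow> o1 e \<in> e" "\<And>x. card {e\<in>F. o1 e = x} \<le> c x" by blast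
    define c' where "c' x = (if x \<in> \<Union>F then 0 else c x)" for x
    have "\<exists>o'. (\<forall>e\<in>E - F. o' e \<in> e) \<and> (\<forall>x. card {e\<in>E - F. o' e = x} \<le> c' x)"
    proof (rule less.hyps)
      show "card (E - F) < card E" using 2 less.prems by (intro psubset_card_mono) auto
      show "finite (E - F)" "\<And>e. e \<in> E - F \<Longrightarrow> finite e" using less.prems by auto
      fix F' assume F': "F' \<subseteq> E - F"
      have "card F + card F' = card (F \<union> F')"
        using F' 2 less.prems(1) by (intro card_Un_disjoint[symmetric]) (auto intro: finite_subset)
      also have "\<dots> \<le> (\<Sum>x\<in>\<Union>(F \<union> F'). c x)" using F' 2 by (intro less.prems(3)) auto
      also have "\<Union>(F \<union> F') = \<Union>F \<union> (\<Union>F' - \<Union>F)" by auto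
      also have "(\<Sum>x\<in>\<dots>. c x) = (\<Sum>x\<in>\<Union>F. c x) + (\<Sum>x\<in>\<Union>F' - \<Union>F. c x)"
        using F' 2 finU[of F] finU[of F'] by (intro sum.union_disjoint) auto
      also have "(\<Sum>x\<in>\<Union>F' - \<Union>F. c x) = (\<Sum>x\<in>\<Union>F'. c' x)"
        unfolding c'_def using F' finU[of F']
        by (subst sum.If_cases) (auto intro!: sum.cong)
      finally show "card F' \<le> (\<Sum>x\<in>\<Union>F'. c' x)" using 2 by simp
    qed
    then obtain o2 where o2: "\<And>e. e \<in> E - F \<Longrightarrow> o2 e \<in> e" "\<And>x. card {e\<in>E - F. o2 e = x} \<le> c' x" by blast
    define o' where "o' e = (if e \<in> F then o1 e else o2 e)" for e
    have "card {e\<in>E. o' e = x} \<le> c x" for x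
    proof -
      have split: "{e\<in>E. o' e = x} = {e\<in>F. o1 e = x} \<union> {e\<in>E - F. o2 e = x}"
        using 2 by (auto simp: o'_def)
      show ?thesis
      proof (cases "x \<in> \<Union>F")
        case True
        then have "{e\<in>E - F. o2 e = x} = {}" using o2(2)[of x] less.prems(1) by (simp add: c'_def)
        then have "{e\<in>E. o' e = x} = {e\<in>F. o1 e = x}" using split by (simp only: Un_empty_right)
        then show ?thesis using o1(2)[of x] by (simp only:)
      next
        case False
        then have "{e\<in>F. o1 e = x} = {}" using o1(1) by auto
        then have "{e\<in>E. o' e = x} = {e\<in>E - F. o2 e = x}" using split by (simp only: Un_empty_left)
        then show ?thesis using o2(2)[of x] False by (simp only: c'_def if_False)
      qed
    qed
    then show ?thesis using o1 o2 2 by (intro exI[of _ o']) (auto simp: o'_def)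
  next
    case 3
    then obtain e where e: "e \<in> E" by auto
    have "1 \<le> (\<Sum>x\<in>e. c x)" using less.prems(3)[of "{e}"] e by simp
    then obtain x where x: "x \<in> e" "0 < c x" by (metis not_one_le_zero sum.neutral zero_less_iff_neq_zero)
    have "\<exists>o'. (\<forall>e\<in>E - {e}. o' e \<in> e) \<and> (\<forall>y. card {e'\<in>E - {e}. o' e' = y} \<le> (c(x := c x - 1)) y)"
    proof (rule less.hyps)
      show "card (E - {e}) < card E" using e less.prems by (intro psubset_card_mono) auto
      show "finite (E - {e})" "\<And>e'. e' \<in> E - {e} \<Longrightarrow> finite e'" using less.prems by auto
      fix F assume F: "F \<subseteq> E - {e}"
      show "card F \<le> (\<Sum>y\<in>\<Union>F. (c(x := c x - 1)) y)"
      proof (cases "F = {}")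
        case False
        have lt: "card F < (\<Sum>y\<in>\<Union>F. c y)" using F e False by (intro 3(2)) auto
        have fU: "finite (\<Union>F)" using F by (intro finU) auto
        have "(\<Sum>y\<in>\<Union>F. c y) \<le> (\<Sum>y\<in>\<Union>F. (c(x := c x - 1)) y + (if y = x then 1 else 0))"
          using x by (intro sum_mono) auto
        also have "\<dots> = (\<Sum>y\<in>\<Union>F. (c(x := c x - 1)) y) + (\<Sum>y\<in>\<Union>F. if y = x then 1 else 0)"
          by (rule sum.distrib)
        also have "(\<Sum>y\<in>\<Union>F. if y = x then 1 else 0) \<le> (1::nat)" using fU by (simp add: sum.delta)
        finally show ?thesis using lt by simp
      qed simp
    qed
    then obtain o1 where o1: "\<And>e'. e' \<in> E - {e} \<Longrightarrow> o1 e' \<in> e'"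
      "\<And>y. card {e'\<in>E - {e}. o1 e' = y} \<le> (c(x := c x - 1)) y" by blast
    have "card {e'\<in>E. (o1(e := x)) e' = y} \<le> c y" for y
    proof (cases "y = x")
      case True
      have "{e'\<in>E. (o1(e := x)) e' = y} = insert e {e'\<in>E - {e}. o1 e' = y}" using e True by auto
      then have "card {e'\<in>E. (o1(e := x)) e' = y} \<le> Suc (card {e'\<in>E - {e}. o1 e' = y})"
        by (simp add: card_insert_le_m1)
      then show ?thesis using o1(2)[of y] True x by simp
    next
      case False
      have "{e'\<in>E. (o1(e := x)) e' = y} = {e'\<in>E - {e}. o1 e' = y}" using False by auto
      then show ?thesis using o1(2)[of y] False by simp
    qed
    then show ?thesis using o1 x by (intro exI[of _ "o1(e := x)"]) auto
  qed
qed

subsection \<open>Deleting reducible vertex sets\<close>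

text \<open>The only features of a copy of \<open>H\<close> that Breaker's strategies use are its numbers of vertices and
  edges and its minimum degree.\<close>
definition copy_on :: "nat \<Rightarrow> nat \<Rightarrow> nat \<Rightarrow> 'a set \<Rightarrow> 'a set set \<Rightarrow> bool" where
  "copy_on p q d W F \<longleftrightarrow> finite W \<and> card W = p \<and> card F = q \<and> (\<forall>f\<in>F. f \<subseteq> W)
     \<and> (\<forall>w\<in>W. d \<le> card (incident F w))"

definition no_copy :: "nat \<Rightarrow> nat \<Rightarrow> nat \<Rightarrow> 'a set set \<Rightarrow> bool" where
  "no_copy p q d M \<longleftrightarrow> (\<forall>W F. F \<subseteq> M \<longrightarrow> \<not> copy_on p q d W F)"

lemma copy_on_subset:
  assumes "copy_on p q d W F" "F \<subseteq> inner E U" "0 < d"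
  shows "W \<subseteq> U"
proof
  fix w assume "w \<in> W"
  then have "0 < card (incident F w)" using assms by (force simp: copy_on_def)
  then obtain f where "f \<in> F" "w \<in> f" by (auto simp: incident_def card_gt_0_iff)
  then show "w \<in> U" using assms by (auto simp: inner_def)
qed

lemma copy_on_inner:
  "copy_on p q d W F \<Longrightarrow> F \<subseteq> M \<Longrightarrow> F \<subseteq> inner M W"
  by (auto simp: copy_on_def inner_def)

lemma copy_on_card_le:
  assumes "copy_on p q d W F" "F \<subseteq> M"
  shows "q \<le> card (inner M W)"
proof -
  have "card F \<le> card (inner M W)"
    using assms copy_on_inner[OF assms] by (intro card_mono finite_inner) (auto simp: copy_on_def)
  then show ?thesis using assms by (simp add: copy_on_def)
qed

text \<open>On the edges meeting \<open>X\<close> Breaker can prevent all copies that meet \<open>X\<close>, even if Maker owns every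
  other edge.\<close>
definition reducible :: "'a set set \<Rightarrow> nat \<Rightarrow> nat \<Rightarrow> nat \<Rightarrow> 'a set \<Rightarrow> bool" where
  "reducible E p q d U \<longleftrightarrow> (\<exists>X\<subseteq>U. X \<noteq> {} \<and>
     breaker_forces (\<lambda>M. M \<subseteq> inner E U - inner E (U - X) \<and>
         (\<forall>W F. F \<subseteq> M \<union> inner E (U - X) \<longrightarrow> W \<inter> X \<noteq> {} \<longrightarrow> \<not> copy_on p q d W F))
       {} (inner E U - inner E (U - X)))"

text \<open>The vertex set is peeled in layers, each removing a reducible \<open>X\<close>; a vertex
  of degree at most \<open>2 * k\<close> always is one, since Maker gets only \<open>k\<close> of
  its edges. A copy that meets \<open>X\<close> is ruled out by the layer of \<open>X\<close>
  whatever happens below, and any other copy lies entirely below. Hence \<open>step\<close> is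
  required only for sets of minimum degree above \<open>2 * k\<close>.\<close>

lemma core_reduction:
  assumes E: "two_sets E" and V: "finite V" and q: "0 < q"
    and step: "\<And>U. U \<subseteq> V \<Longrightarrow> U \<noteq> {} \<Longrightarrow> (\<And>x. x \<in> U \<Longrightarrow> 2 * k < card (incident (inner E U) x)) \<Longrightarrow>
      reducible E p q (Suc k) U"
  shows "breaker_forces (no_copy p q (Suc k)) {} (inner E V)"
proof -
  have "breaker_forces (\<lambda>M. M \<subseteq> inner E U \<and> no_copy p q (Suc k) M) {} (inner E U)" if "U \<subseteq> V" for U
    using finite_subset[OF that V] that
  proof (induction rule: finite_psubset_induct)
    case (psubset U)
    show ?case
    proof (cases "U = {}")
      case True
      then have "inner E U = {}" using E by (auto simp: inner_def two_sets_def)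
      then show ?thesis using q
        by (auto intro!: breaker_forces.breaker_forcesI simp: no_copy_def copy_on_def)
    next
      case False
      have "reducible E p q (Suc k) U"
      proof (cases "\<exists>x\<in>U. card (incident (inner E U) x) \<le> 2 * k")
        case True
        then obtain x where x: "x \<in> U" "card (incident (inner E U) x) \<le> 2 * k" by blast
        have fin: "finite (incident (inner E U) x)"
          using psubset.hyps by (simp add: finite_inner finite_incident)
        have eq: "inner E U - inner E (U - {x}) = incident (inner E U) x"
          by (auto simp: inner_def incident_def)
        have "breaker_forces (\<lambda>M. M \<subseteq> incident (inner E U) x \<and>
          (\<forall>W F. F \<subseteq> M \<union> inner E (U - {x}) \<longrightarrow> W \<inter> {x} \<noteq> {} \<longrightarrow> \<not> copy_on p q (Suc k) W F)) {}
          (incident (inner E U) x)"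
        proof (rule breaker_forces_mono[OF breaker_forces_half[OF fin x(2)]], intro conjI allI impI notI)
          fix M assume M: "M \<subseteq> incident (inner E U) x \<and> card M \<le> k"
          then show "M \<subseteq> incident (inner E U) x" by blast
          fix W F assume F: "F \<subseteq> M \<union> inner E (U - {x})" "W \<inter> {x} \<noteq> {}" "copy_on p q (Suc k) W F"
          have "incident F x \<subseteq> M" using F(1) by (auto simp: incident_def inner_def)
          then have "card (incident F x) \<le> card M"
            using M fin by (intro card_mono) (auto intro: finite_subset)
          moreover have "Suc k \<le> card (incident F x)" using F(2,3) by (auto simp: copy_on_def)
          ultimately show False using M by simp
        qed
        then show ?thesis unfolding reducible_def using x(1) eq by (intro exI[of _ "{x}"]) simp
      next
        case False
        then show ?thesis using step[OF psubset.prems \<open>U \<noteq> {}\<close>] by (simp add: not_le)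
      qed
      then obtain X where X: "X \<subseteq> U" "X \<noteq> {}" and
        g1: "breaker_forces (\<lambda>M. M \<subseteq> inner E U - inner E (U - X) \<and>
          (\<forall>W F. F \<subseteq> M \<union> inner E (U - X) \<longrightarrow> W \<inter> X \<noteq> {} \<longrightarrow> \<not> copy_on p q (Suc k) W F)) {}
          (inner E U - inner E (U - X))"
        unfolding reducible_def by blast
      have "breaker_forces (\<lambda>M. M \<subseteq> inner E (U - X) \<and> no_copy p q (Suc k) M) {} (inner E (U - X))"
      proof (rule psubset.IH)
        show "U - X \<subset> U" using X by blast
        then show "U - X \<subseteq> V" using psubset.prems by blast
      qed
      from g1 this show ?thesis
      proof (rule breaker_forces_split)
        show "inner E U \<subseteq> (inner E U - inner E (U - X)) \<union> inner E (U - X)" by blast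
        fix M1 M2 assume M1: "M1 \<subseteq> inner E U - inner E (U - X) \<and>
          (\<forall>W F. F \<subseteq> M1 \<union> inner E (U - X) \<longrightarrow> W \<inter> X \<noteq> {} \<longrightarrow> \<not> copy_on p q (Suc k) W F)"
          and M2: "M2 \<subseteq> inner E (U - X) \<and> no_copy p q (Suc k) M2"
        have "\<not> copy_on p q (Suc k) W F" if F: "F \<subseteq> M1 \<union> M2" for W F
        proof
          assume c: "copy_on p q (Suc k) W F"
          have "F \<subseteq> M1 \<union> inner E (U - X)" using F M2 by blast
          then have "W \<inter> X = {}" using M1 c by blast
          have "e \<notin> M1" if "e \<in> F" for e
          proof
            assume "e \<in> M1"
            then have e: "e \<in> E" "e \<subseteq> U" "e \<notin> inner E (U - X)" using M1 by (auto simp: inner_def)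
            have "e \<subseteq> W" using that c by (simp add: copy_on_def)
            then show False using e \<open>W \<inter> X = {}\<close> by (auto simp: inner_def)
          qed
          then have "F \<subseteq> M2" using F by blast
          then show False using M2 c by (auto simp: no_copy_def)
        qed
        moreover have "inner E (U - X) \<subseteq> inner E U" by (auto simp: inner_def)
        ultimately show "M1 \<union> M2 \<subseteq> inner E U \<and> no_copy p q (Suc k) (M1 \<union> M2)"
          using M1 M2 by (auto simp: no_copy_def)
      qed
    qed
  qed
  from this[OF order_refl] show ?thesis by (rule breaker_forces_mono) simp
qed

subsection \<open>Orientations\<close>

lemma card_eq_sum_groups:
  assumes "finite F" "finite W" "\<And>e. e \<in> F \<Longrightarrow> g e \<in> W"
  shows "card F = (\<Sum>w\<in>W. card {e\<in>F. g e = w})"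
proof -
  have "g ` F \<subseteq> W" using assms(3) by blast
  then show ?thesis using sum.group[of F W g "\<lambda>_. 1 :: nat"] assms(1,2) by simp
qed

text \<open>The vertex \<open>ow e\<close> owns \<open>e\<close>, as its tail. Hall's condition for
  a set of edges is the sparsity of the set of their endpoints.\<close>

lemma sparse_orientation:
  assumes V: "finite V" and E: "two_sets E" "E \<subseteq> Pow V"
    and sparse: "\<And>U. U \<subseteq> V \<Longrightarrow> card (inner E U) \<le> c * card U"
  shows "\<exists>ow. (\<forall>e\<in>E. ow e \<in> e) \<and> (\<forall>x. card {e\<in>E. ow e = x} \<le> c)"
proof (rule hall_capacity[where c = "\<lambda>_. c"])
  show fin: "finite E" using finite_subset[OF E(2)] V by simp
  show "finite e" if "e \<in> E" for e using that E V by (auto intro: finite_subset)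
  fix F assume F: "F \<subseteq> E"
  have "\<Union>F \<subseteq> V" using F E by auto
  moreover have "card F \<le> card (inner E (\<Union>F))"
    using F fin by (intro card_mono) (auto simp: inner_def)
  ultimately show "card F \<le> (\<Sum>x\<in>\<Union>F. c)" using sparse[of "\<Union>F"] by (simp add: mult.commute)
qed

text \<open>Halving the edges owned by each vertex leaves Maker at most \<open>t\<close> of them.
  Every edge of a copy is owned by a vertex of that copy, so Maker has at most \<open>t * p\<close>
  edges on it.\<close>

lemma breaker_forces_oriented:
  assumes E: "finite E"
    and ow: "\<And>e. e \<in> E \<Longrightarrow> ow e \<in> e" "\<And>x. card {e\<in>E. ow e = x} \<le> 2 * t"
    and q: "t * p < q"
  shows "breaker_forces (no_copy p q d) {} E"
proof (rule breaker_forces_mono[OF breaker_forces_groups[OF E, of ow]], unfold no_copy_def, intro allI impI notI)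
  fix M W F assume M: "M \<subseteq> E \<and> (\<forall>i. 2 * card {e\<in>M. ow e = i} \<le> card {e\<in>E. ow e = i} + 1)"
    and F: "F \<subseteq> M" and c: "copy_on p q d W F"
  have finF: "finite F" using F M E by (meson finite_subset)
  have "card {e\<in>F. ow e = w} \<le> t" for w
  proof -
    have "card {e\<in>F. ow e = w} \<le> card {e\<in>M. ow e = w}"
      using F M E by (intro card_mono) (auto intro: finite_subset)
    moreover have "2 * card {e\<in>M. ow e = w} \<le> 2 * t + 1"
      using spec[OF conjunct2[OF M], of w] ow(2)[of w] by linarith
    ultimately show ?thesis by linarith
  qed
  then have "(\<Sum>w\<in>W. card {e\<in>F. ow e = w}) \<le> card W * t"
    using sum_bounded_above[of W "\<lambda>w. card {e\<in>F. ow e = w}" t] by simp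
  moreover have "card F = (\<Sum>w\<in>W. card {e\<in>F. ow e = w})"
  proof (rule card_eq_sum_groups[OF finF])
    fix e assume "e \<in> F"
    then have "e \<subseteq> W" "ow e \<in> e" using c F M ow(1) by (auto simp: copy_on_def)
    then show "ow e \<in> W" by blast
  qed (use c in \<open>simp add: copy_on_def\<close>)
  ultimately show False using c q by (simp add: copy_on_def mult.commute)
qed

text \<open>Let \<open>R\<close> be the set reachable from a vertex along edges directed away from
  their owners. All edges owned in \<open>R\<close> stay inside \<open>R\<close>, so if every vertex
  of \<open>R\<close> owned \<open>c\<close> edges, \<open>R\<close> would violate sparsity. Thus a
  vertex owning fewer than \<open>c\<close> edges is always reachable; the rank is the distance to
  such vertices, and the first edge of a shortest path descends.\<close>

lemma descending_rank:
  assumes V: "finite V" and E: "two_sets E" "E \<subseteq> Pow V"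
    and ow: "\<And>e. e \<in> E \<Longrightarrow> ow e \<in> e"
    and sparse: "\<And>U. U \<subseteq> V \<Longrightarrow> U \<noteq> {} \<Longrightarrow> card (inner E U) < c * card U"
  shows "\<exists>rk :: 'a \<Rightarrow> nat. \<forall>x\<in>V. c \<le> card {e\<in>E. ow e = x} \<longrightarrow>
    (\<exists>y. {x, y} \<in> E \<and> ow {x, y} = x \<and> rk y < rk x)"
proof -
  define r where "r = {(x, y). {x, y} \<in> E \<and> ow {x, y} = x}"
  define D where "D = {x\<in>V. card {e\<in>E. ow e = x} < c}"
  have finE: "finite E" using finite_subset[OF E(2)] V by simp
  have reach: "\<exists>n. \<exists>y\<in>D. (x, y) \<in> r ^^ n" if "x \<in> V" for x
  proof (rule ccontr)
    assume no: "\<not> ?thesis"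
    define R where "R = r\<^sup>* `` {x}"
    have rV: "y \<in> V" if "(z, y) \<in> r" for z y using that E by (auto simp: r_def)
    have "y \<in> V" if "(x, y) \<in> r\<^sup>*" for y
      using that by (induction) (use \<open>x \<in> V\<close> rV in auto)
    then have RV: "R \<subseteq> V" by (auto simp: R_def)
    have "R \<noteq> {}" by (auto simp: R_def)
    have big: "c \<le> card {e\<in>E. ow e = y}" if yR: "y \<in> R" for y
    proof (rule ccontr)
      assume "\<not> ?thesis"
      then have "y \<in> D" using yR RV by (auto simp: D_def)
      moreover obtain n where "(x, y) \<in> r ^^ n" using yR rtrancl_imp_relpow unfolding R_def by blast
      ultimately show False using no by blast
    qed
    define EE where "EE = {e\<in>E. ow e \<in> R}"
    have "EE \<subseteq> inner E R"
    proof
      fix e assume "e \<in> EE"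
      then have e: "e \<in> E" "ow e \<in> R" by (auto simp: EE_def)
      then obtain y where y: "e = {ow e, y}" using ow E(1) by (metis two_set_cases two_sets_def)
      then have "(ow e, y) \<in> r" using e by (simp add: r_def)
      then have "y \<in> R" using e(2) by (auto simp: R_def)
      then have "{ow e, y} \<subseteq> R" using e by simp
      then show "e \<in> inner E R" using e(1) y by (simp only: inner_def mem_Collect_eq simp_thms)
    qed
    then have "card EE \<le> card (inner E R)" using RV V by (intro card_mono finite_inner) (auto intro: finite_subset)
    moreover have "card EE = (\<Sum>y\<in>R. card {e\<in>EE. ow e = y})"
      using finE RV V by (intro card_eq_sum_groups) (auto simp: EE_def intro: finite_subset)
    moreover have "(\<Sum>y\<in>R. card {e\<in>EE. ow e = y}) \<ge> (\<Sum>y\<in>R. c)"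
    proof (rule sum_mono)
      fix y assume "y \<in> R"
      then have "{e\<in>EE. ow e = y} = {e\<in>E. ow e = y}" by (auto simp: EE_def)
      then show "c \<le> card {e\<in>EE. ow e = y}" using big[OF \<open>y \<in> R\<close>] by simp
    qed
    ultimately show False using sparse[OF RV \<open>R \<noteq> {}\<close>] by (simp add: mult.commute)
  qed
  define rk where "rk x = (LEAST n. \<exists>y\<in>D. (x, y) \<in> r ^^ n)" for x
  have "\<exists>y. {x, y} \<in> E \<and> ow {x, y} = x \<and> rk y < rk x" if x: "x \<in> V" "c \<le> card {e\<in>E. ow e = x}" for x
  proof -
    obtain z where z: "z \<in> D" "(x, z) \<in> r ^^ rk x"
      unfolding rk_def using LeastI_ex[OF reach[OF x(1)]] by blast
    have "x \<notin> D" using x by (simp add: D_def)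
    then obtain n where n: "rk x = Suc n" using z by (cases "rk x") auto
    then obtain y where y: "(x, y) \<in> r" "(y, z) \<in> r ^^ n" using z(2) relpow_Suc_D2 by metis
    have "rk y \<le> n" unfolding rk_def using y z by (intro Least_le) blast
    then show ?thesis using y n by (auto simp: r_def)
  qed
  then show ?thesis by blast
qed

text \<open>The odd edge out of every vertex that owns three edges points down a rank, so that a subgraph in
  which Maker owns two edges at every vertex would have no vertex of least rank.\<close>
lemma breaker_forces_oriented_three:
  assumes V: "finite V" and E: "two_sets E" "E \<subseteq> Pow V"
    and sparse: "\<And>U. U \<subseteq> V \<Longrightarrow> U \<noteq> {} \<Longrightarrow> card (inner E U) < 3 * card U"
    and p: "0 < p"
  shows "breaker_forces (no_copy p (2 * p) d) {} E"
proof -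
  have sparse': "card (inner E U) \<le> 3 * card U" if "U \<subseteq> V" for U
  proof (cases "U = {}")
    case True
    then have "inner E U = {}" using E(1) by (auto simp: inner_def two_sets_def)
    then show ?thesis by simp
  qed (use sparse[OF that] in simp)
  obtain ow where ow: "\<And>e. e \<in> E \<Longrightarrow> ow e \<in> e" "\<And>x. card {e\<in>E. ow e = x} \<le> 3"
    using sparse_orientation[OF V E sparse'] by blast
  obtain rk :: "'a \<Rightarrow> nat" where rk: "\<And>x. x \<in> V \<Longrightarrow> 3 \<le> card {e\<in>E. ow e = x} \<Longrightarrow>
      \<exists>y. {x, y} \<in> E \<and> ow {x, y} = x \<and> rk y < rk x"
    using descending_rank[OF V E ow(1) sparse] by blast
  have finE: "finite E" using finite_subset[OF E(2)] V by simp
  define nx where "nx x = (SOME y. {x, y} \<in> E \<and> ow {x, y} = x \<and> rk y < rk x)" for x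
  have nx: "{x, nx x} \<in> E" "ow {x, nx x} = x" "rk (nx x) < rk x"
    if "x \<in> V" "3 \<le> card {e\<in>E. ow e = x}" for x
    using someI_ex[OF rk[OF that]] by (simp_all add: nx_def)
  define full where "full x \<longleftrightarrow> x \<in> V \<and> 3 \<le> card {e\<in>E. ow e = x}" for x
  \<comment> \<open>At a vertex that owns three edges the descending one forms a group of its own,
    conceded to Maker, and the other two are paired. So Maker can own two edges there only by using
    the descending one.\<close>
  define g where "g e = (ow e, full (ow e) \<and> e = {ow e, nx (ow e)})" for e
  show ?thesis
  proof (rule breaker_forces_mono[OF breaker_forces_groups[OF finE, of g]], unfold no_copy_def, intro allI impI notI)
    fix M W F
    assume M: "M \<subseteq> E \<and> (\<forall>i. 2 * card {e\<in>M. g e = i} \<le> card {e\<in>E. g e = i} + 1)"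
      and F: "F \<subseteq> M" and c: "copy_on p (2 * p) d W F"
    have finM: "finite M" using M finE by (auto intro: finite_subset)
    have gM: "card {e\<in>M. g e = (x, False)} \<le> 1" if "x \<in> V" for x
    proof -
      have "card {e\<in>E. g e = (x, False)} \<le> 2"
      proof (cases "full x")
        case True
        have "{e\<in>E. g e = (x, False)} \<subseteq> {e\<in>E. ow e = x} - {{x, nx x}}" using True by (auto simp: g_def)
        then have "card {e\<in>E. g e = (x, False)} \<le> card ({e\<in>E. ow e = x} - {{x, nx x}})"
          using finE by (intro card_mono) auto
        also have "\<dots> = card {e\<in>E. ow e = x} - 1"
          using nx(1,2)[of x] True by (intro card_Diff_singleton) (auto simp: full_def)
        finally show ?thesis using ow(2)[of x] by simp
      next
        case False
        have "card {e\<in>E. g e = (x, False)} \<le> card {e\<in>E. ow e = x}"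
          using finE by (intro card_mono) (auto simp: g_def)
        then show ?thesis using False that by (simp add: full_def)
      qed
      then have "2 * card {e\<in>M. g e = (x, False)} \<le> 3"
        using spec[OF conjunct2[OF M], of "(x, False)"] by linarith
      then show ?thesis by simp
    qed
    have gT: "{e\<in>M. g e = (x, True)} \<subseteq> (if full x then {{x, nx x}} else {})" for x
      by (auto simp: g_def)
    have split: "card {e\<in>F. ow e = x} \<le> card {e\<in>M. g e = (x, False)} + card (F \<inter> {e\<in>M. g e = (x, True)})" for x
    proof -
      have "{e\<in>F. ow e = x} \<subseteq> {e\<in>M. g e = (x, False)} \<union> (F \<inter> {e\<in>M. g e = (x, True)})"
        using F by (auto simp: g_def)
      then have "card {e\<in>F. ow e = x} \<le> card ({e\<in>M. g e = (x, False)} \<union> (F \<inter> {e\<in>M. g e = (x, True)}))"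
        using finM by (intro card_mono) auto
      also have "\<dots> \<le> card {e\<in>M. g e = (x, False)} + card (F \<inter> {e\<in>M. g e = (x, True)})"
        by (rule card_Un_le)
      finally show ?thesis .
    qed
    have T1: "card (F \<inter> {e\<in>M. g e = (x, True)}) \<le> 1" for x
    proof -
      have "F \<inter> {e\<in>M. g e = (x, True)} \<subseteq> {{x, nx x}}" using gT[of x] by (auto split: if_splits)
      from card_mono[OF _ this] show ?thesis by simp
    qed
    have finW: "finite W" "card W = p" "card F = 2 * p" "\<And>f. f \<in> F \<Longrightarrow> f \<subseteq> W" using c by (auto simp: copy_on_def)
    have le2: "card {e\<in>F. ow e = w} \<le> 2" if "w \<in> V" for w
      using split[of w] T1[of w] gM[OF that] by linarith
    have le2': "card {e\<in>F. ow e = w} \<le> 2" for w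
    proof (cases "w \<in> V")
      case False
      then have "{e\<in>F. ow e = w} = {}" using F M ow(1) E(2) by blast
      then show ?thesis by (simp only: card.empty)
    qed (rule le2)
    have tot: "card F = (\<Sum>w\<in>W. card {e\<in>F. ow e = w})"
    proof (rule card_eq_sum_groups)
      show "finite F" using F finM by (rule finite_subset)
      fix e assume "e \<in> F"
      then show "ow e \<in> W" using finW(4) F M ow(1) by blast
    qed (rule finW)
    \<comment> \<open>The \<open>2 * p\<close> edges are distributed over \<open>p\<close> owners
      with at most two each, so no owner can fall short.\<close>
    have all2: "card {e\<in>F. ow e = w} = 2" if "w \<in> W" for w
    proof (rule ccontr)
      assume "card {e\<in>F. ow e = w} \<noteq> 2"
      then have "card {e\<in>F. ow e = w} < 2" using le2'[of w] by simp
      then have "(\<Sum>w\<in>W. card {e\<in>F. ow e = w}) < (\<Sum>w\<in>W. 2)"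
        using le2' that finW(1) by (intro sum_strict_mono_ex1) auto
      then show False using tot finW by simp
    qed
    have down: "nx w \<in> W \<and> rk (nx w) < rk w" if w: "w \<in> W" for w
    proof -
      have "{e\<in>F. ow e = w} \<noteq> {}" using all2[OF w] by (metis card.empty zero_neq_numeral)
      then have wV: "w \<in> V" using F M ow(1) E(2) by blast
      have "card (F \<inter> {e\<in>M. g e = (w, True)}) \<noteq> 0" using split[of w] all2[OF w] gM[OF wV] by linarith
      then have "F \<inter> {e\<in>M. g e = (w, True)} \<noteq> {}" by (metis card.empty)
      then have "full w" "{w, nx w} \<in> F" using gT[of w] by (auto split: if_splits)
      then show ?thesis using nx[of w] finW(4) by (auto simp: full_def)
    qed
    have "W \<noteq> {}" using finW p by auto
    then obtain w where "w \<in> W" "\<And>x. x \<in> W \<Longrightarrow> rk w \<le> rk x"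
      using arg_min_if_finite(1)[of W rk] arg_min_least[of W _ rk] finW(1) by blast
    then show False using down by (meson not_le)
  qed
qed

subsection \<open>Nearly 5-regular graphs\<close>

text \<open>Otherwise the set \<open>S\<close> of vertices of degree 5 is independent. Its edge
  stars are then disjoint, so 5 |S| <= e, while the degree sum gives 6 |U| <= 2 e + |S|. Together 6
  |U| <= (11/5) e <= (88/15) |U|, which is impossible.\<close>

lemma adjacent_degree_five:
  assumes "finite U" "U \<noteq> {}" "two_sets E"
    and deg: "\<And>x. x \<in> U \<Longrightarrow> 5 \<le> card (incident (inner E U) x)"
    and sparse: "3 * card (inner E U) \<le> 8 * card U"
  shows "\<exists>x\<in>U. \<exists>y\<in>U. x \<noteq> y \<and> {x, y} \<in> E \<and>
    card (incident (inner E U) x) = 5 \<and> card (incident (inner E U) y) = 5"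
proof (rule ccontr)
  assume none: "\<not> ?thesis"
  then have no: "\<not> (card (incident (inner E U) x) = 5 \<and> card (incident (inner E U) y) = 5)"
    if "x \<in> U" "y \<in> U" "x \<noteq> y" "{x, y} \<in> E" for x y using that none by blast
  define S where "S = {x\<in>U. card (incident (inner E U) x) = 5}"
  have finS: "finite S" using assms(1) by (simp add: S_def)
  have disj: "incident (inner E U) x \<inter> incident (inner E U) y = {}" if "x \<in> S" "y \<in> S" "x \<noteq> y" for x y
  proof (rule ccontr)
    assume "\<not> ?thesis"
    then obtain e where e: "e \<in> E" "x \<in> e" "y \<in> e" by (auto simp: incident_def inner_def)
    then have "e = {x, y}" using two_sets_eq[OF assms(3)] that(3) by blast
    then show False using no[of x y] e that by (simp add: S_def)
  qed
  have "card (\<Union>x\<in>S. incident (inner E U) x) = (\<Sum>x\<in>S. card (incident (inner E U) x))"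
    using finS disj assms(1) by (intro card_UN_disjoint) (auto intro: finite_incident finite_inner)
  also have "\<dots> = 5 * card S" by (simp add: S_def)
  finally have "5 * card S \<le> card (inner E U)"
    using card_mono[of "inner E U" "\<Union>x\<in>S. incident (inner E U) x"] assms(1)
    by (auto simp: incident_def finite_inner)
  moreover have "6 * card U \<le> 2 * card (inner E U) + card S"
  proof -
    have "6 * card U = (\<Sum>x\<in>U. 6)" by simp
    also have "\<dots> \<le> (\<Sum>x\<in>U. card (incident (inner E U) x) + (if x \<in> S then 1 else 0))"
    proof (rule sum_mono)
      fix x assume "x \<in> U"
      then show "6 \<le> card (incident (inner E U) x) + (if x \<in> S then 1 else 0)"
        using deg[of x] by (auto simp: S_def)
    qed
    also have "\<dots> = 2 * card (inner E U) + (\<Sum>x\<in>U. if x \<in> S then 1 else 0)"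
      using handshake[OF assms(1,3)] by (simp add: sum.distrib)
    also have "(\<Sum>x\<in>U. if x \<in> S then 1 else 0) = card S"
    proof -
      have "U \<inter> {x. x \<in> S} = S" by (auto simp: S_def)
      then show ?thesis using assms(1) by (simp add: sum.If_cases)
    qed
    finally show ?thesis .
  qed
  moreover have "card U > 0" using assms(1,2) by (simp add: card_gt_0_iff)
  ultimately show False using sparse by linarith
qed

text \<open>Breaker halves the four other edges at \<open>x\<close> and those at \<open>y\<close>
  separately and concedes \<open>{x, y}\<close>. Without that edge neither vertex reaches degree 3,
  so a copy meeting \<open>{x, y}\<close> uses it and contains both vertices; it then has at most 2
  + 2 + 1 + 3 = 8 edges, the 3 being those among its other three vertices.\<close>

lemma adjacent_degree_five_reducible:
  assumes U: "finite U" and E: "two_sets E"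
    and xy: "x \<in> U" "y \<in> U" "x \<noteq> y" "{x, y} \<in> E"
    and deg: "card (incident (inner E U) x) = 5" "card (incident (inner E U) y) = 5"
  shows "reducible E 5 9 3 U"
proof -
  define Ex where "Ex = incident (inner E U) x - {{x, y}}"
  define Ey where "Ey = incident (inner E U) y - {{x, y}}"
  have fin: "finite Ex" "finite Ey" using U by (auto simp: Ex_def Ey_def finite_inner finite_incident)
  have xyE: "{x, y} \<in> incident (inner E U) x" "{x, y} \<in> incident (inner E U) y"
    using xy by (auto simp: incident_def inner_def)
  have "card Ex = 4" unfolding Ex_def using xyE(1) deg by (subst card_Diff_singleton) auto
  moreover have "card Ey = 4" unfolding Ey_def using xyE(2) deg by (subst card_Diff_singleton) auto
  ultimately have c: "card Ex \<le> 2 * 2" "card Ey \<le> 2 * 2" "card {{x, y}} \<le> 2 * 1" by auto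
  have gxy: "breaker_forces (\<lambda>M. \<exists>M1 M2. M = M1 \<union> M2 \<and> M1 \<subseteq> Ex \<and> card M1 \<le> 2 \<and> M2 \<subseteq> Ey \<and> card M2 \<le> 2) {} (Ex \<union> Ey)"
    by (rule breaker_forces_split[OF breaker_forces_half[OF fin(1) c(1)] breaker_forces_half[OF fin(2) c(2)]]) auto
  have eq: "inner E U - inner E (U - {x, y}) = Ex \<union> Ey \<union> {{x, y}}"
    using xy by (auto simp: Ex_def Ey_def inner_def incident_def)
  have "breaker_forces (\<lambda>M. M \<subseteq> inner E U - inner E (U - {x, y}) \<and>
        (\<forall>W F. F \<subseteq> M \<union> inner E (U - {x, y}) \<longrightarrow> W \<inter> {x, y} \<noteq> {} \<longrightarrow> \<not> copy_on 5 9 3 W F)) {}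
        (inner E U - inner E (U - {x, y}))"
  proof (rule breaker_forces_split[OF gxy breaker_forces_half[of "{{x, y}}" 1]])
    show "inner E U - inner E (U - {x, y}) \<subseteq> Ex \<union> Ey \<union> {{x, y}}" using eq by simp
    fix M' M3 assume "\<exists>M1 M2. M' = M1 \<union> M2 \<and> M1 \<subseteq> Ex \<and> card M1 \<le> 2 \<and> M2 \<subseteq> Ey \<and> card M2 \<le> 2"
      and M3: "M3 \<subseteq> {{x, y}} \<and> card M3 \<le> 1"
    then obtain M1 M2 where M': "M' = M1 \<union> M2" and M1: "M1 \<subseteq> Ex" "card M1 \<le> 2" and M2: "M2 \<subseteq> Ey" "card M2 \<le> 2"
      by blast
    show "M' \<union> M3 \<subseteq> inner E U - inner E (U - {x, y}) \<and>
        (\<forall>W F. F \<subseteq> M' \<union> M3 \<union> inner E (U - {x, y}) \<longrightarrow> W \<inter> {x, y} \<noteq> {} \<longrightarrow> \<not> copy_on 5 9 3 W F)"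
    proof (intro conjI allI impI notI)
      show "M' \<union> M3 \<subseteq> inner E U - inner E (U - {x, y})" unfolding eq using M' M1 M2 M3 by blast
      fix W F assume F: "F \<subseteq> M' \<union> M3 \<union> inner E (U - {x, y})" and W: "W \<inter> {x, y} \<noteq> {}"
        and cp: "copy_on 5 9 3 W F"
      have cW: "finite W" "card W = 5" "card F = 9" "\<And>f. f \<in> F \<Longrightarrow> f \<subseteq> W"
        "\<And>w. w \<in> W \<Longrightarrow> 3 \<le> card (incident F w)" using cp by (auto simp: copy_on_def)
      have Fdec: "F \<subseteq> M1 \<union> M2 \<union> {{x, y}} \<union> inner E (U - {x, y})" using F M' M3 by blast
      have finM: "finite M1" "finite M2" using M1 M2 fin by (auto intro: finite_subset)
      have xyF: "{x, y} \<in> F"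
      proof (rule ccontr)
        assume n: "{x, y} \<notin> F"
        have "e \<in> M1" if e: "e \<in> F" "x \<in> e" for e
          using e n Fdec M2(1) two_sets_eq[OF E, of e x y] xy(3) by (auto simp: incident_def inner_def Ey_def)
        then have "incident F x \<subseteq> M1" by (auto simp: incident_def)
        then have "card (incident F x) \<le> 2" by (rule order_trans[OF card_mono[OF finM(1)] M1(2)])
        then have "x \<notin> W" using cW(5)[of x] by linarith
        have "e \<in> M2" if e: "e \<in> F" "y \<in> e" for e
          using e n Fdec M1(1) two_sets_eq[OF E, of e x y] xy(3) by (auto simp: incident_def inner_def Ex_def)
        then have "incident F y \<subseteq> M2" by (auto simp: incident_def)
        then have "card (incident F y) \<le> 2" by (rule order_trans[OF card_mono[OF finM(2)] M2(2)])
        then have "y \<notin> W" using cW(5)[of y] by linarith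
        then show False using \<open>x \<notin> W\<close> W by blast
      qed
      then have xyW: "x \<in> W" "y \<in> W" using cW(4) by auto
      define I where "I = inner E (W - {x, y})"
      have "card (W - {x, y}) = 3" using xyW xy(3) cW(1,2) by (subst card_Diff_subset) auto
      then have cI: "card I \<le> 3" using card_inner_le_choose[of "W - {x, y}" E] cW(1) E
        by (simp add: I_def numeral_3_eq_3 numeral_2_eq_2)
      have "F \<subseteq> M1 \<union> M2 \<union> {{x, y}} \<union> I"
        using Fdec cW(4) by (fastforce simp: I_def inner_def)
      then have "card F \<le> card (M1 \<union> M2 \<union> {{x, y}} \<union> I)"
        using finM cW(1) by (intro card_mono) (auto simp: I_def finite_inner)
      also have "\<dots> \<le> card M1 + card M2 + card {{x, y}} + card I"
        by (meson add_le_mono card_Un_le order_refl order_trans)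
      finally show False using M1 M2 cI cW(3) by simp
    qed
  qed auto
  then show ?thesis unfolding reducible_def using xy by (intro exI[of _ "{x, y}"]) simp
qed

lemma regular_core:
  assumes "finite U" "two_sets E"
    and deg: "\<And>x. x \<in> U \<Longrightarrow> r \<le> card (incident (inner E U) x)"
    and sparse: "2 * card (inner E U) \<le> r * card U"
    and "x \<in> U"
  shows "card (incident (inner E U) x) = r"
proof (rule ccontr)
  assume "\<not> ?thesis"
  then have "r < card (incident (inner E U) x)" using deg[OF \<open>x \<in> U\<close>] by simp
  then have "(\<Sum>x\<in>U. r) < (\<Sum>x\<in>U. card (incident (inner E U) x))"
    using assms by (intro sum_strict_mono_ex1) auto
  then show False using handshake[OF assms(1,2)] sparse by (simp add: mult.commute)
qed

section \<open>Components and the removal of one vertex from them\<close>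

definition closed_in :: "'a set set \<Rightarrow> 'a set \<Rightarrow> bool" where
  "closed_in A C \<longleftrightarrow> (\<forall>e\<in>A. e \<inter> C \<noteq> {} \<longrightarrow> e \<subseteq> C)"

text \<open>Minimality of closed sets replaces connectedness by paths.\<close>
definition component :: "'a set set \<Rightarrow> 'a set \<Rightarrow> bool" where
  "component A C \<longleftrightarrow> C \<noteq> {} \<and> closed_in A C \<and> (\<forall>C'. C' \<subset> C \<longrightarrow> C' \<noteq> {} \<longrightarrow> \<not> closed_in A C')"

lemma component_exists:
  assumes "finite U" "U \<noteq> {}" "A \<subseteq> Pow U"
  obtains C where "C \<subseteq> U" "component A C"
proof -
  have "\<exists>C\<subseteq>U. component A C" if "U \<noteq> {}" "closed_in A U"
    using assms(1) that
  proof (induction rule: finite_psubset_induct)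
    case (psubset U)
    show ?case
    proof (cases "component A U")
      case False
      then obtain C' where "C' \<subset> U" "C' \<noteq> {}" "closed_in A C'"
        using psubset.prems by (auto simp: component_def)
      then show ?thesis using psubset.IH[of C'] by blast
    qed blast
  qed
  then show ?thesis using that assms by (auto simp: closed_in_def)
qed

lemma regular_component:
  assumes "finite U" "U \<noteq> {}" "two_sets E"
    and "\<And>x. x \<in> U \<Longrightarrow> r \<le> card (incident (inner E U) x)" "2 * card (inner E U) \<le> r * card U"
  shows "\<exists>C\<subseteq>U. component (inner E U) C \<and> (\<forall>x\<in>C. card (incident (inner E U) x) = r)"
proof -
  have "inner E U \<subseteq> Pow U" by (auto simp: inner_def)
  from component_exists[OF assms(1,2) this] obtain C where C: "C \<subseteq> U" "component (inner E U) C" .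
  have "card (incident (inner E U) x) = r" if "x \<in> C" for x
    using regular_core[OF assms(1,3,4,5)] C(1) that by blast
  with C show ?thesis by blast
qed

text \<open>A proper nonempty subset is not closed, so some edge leaves it and its endpoint inside
  loses a degree. This is why deleting a single vertex makes a regular component degenerate.\<close>

lemma component_subset_degree:
  assumes C: "component A C" and A: "finite A" and deg: "\<And>x. x \<in> C \<Longrightarrow> card (incident A x) \<le> Suc r"
    and U: "U \<subset> C" "U \<noteq> {}"
  shows "\<exists>x\<in>U. card (incident (inner A U) x) \<le> r"
proof -
  have "\<not> closed_in A U" using C U by (auto simp: component_def)
  then obtain e x where e: "e \<in> A" "x \<in> e" "x \<in> U" "\<not> e \<subseteq> U" by (auto simp: closed_in_def)
  have "incident (inner A U) x \<subset> incident A x" using e by (auto simp: incident_def inner_def)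
  then have "card (incident (inner A U) x) < card (incident A x)"
    using A by (intro psubset_card_mono finite_incident)
  moreover have "card (incident A x) \<le> Suc r" using deg e U by blast
  ultimately show ?thesis using e(3) by (intro bexI[of _ x]) auto
qed

lemma incident_closed:
  assumes "closed_in A C" "x \<in> C"
  shows "incident (inner A C) x = incident A x"
  using assms by (auto simp: closed_in_def incident_def inner_def)

text \<open>A substitute for connectedness of \<open>H\<close>, which \<open>copy_on\<close> does
  not record: a closed part of the copy has minimum degree at least k + 1 and hence at least k + 2
  vertices, so there is no room for two.\<close>

lemma copy_on_closed:
  assumes cp: "copy_on p q (Suc k) W F" and F: "two_sets F" "closed_in F C"
    and p: "p < 2 * (k + 2)" and W: "W \<inter> C \<noteq> {}"
  shows "W \<subseteq> C"
proof (rule ccontr)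
  assume "\<not> W \<subseteq> C"
  have fW: "finite W" "card W = p" "\<And>f. f \<in> F \<Longrightarrow> f \<subseteq> W" "\<And>w. w \<in> W \<Longrightarrow> Suc k \<le> card (incident F w)"
    using cp by (auto simp: copy_on_def)
  have big: "k + 2 \<le> card D" if D: "D \<subseteq> W" "D \<noteq> {}" "closed_in F D" for D
  proof -
    obtain w where "w \<in> D" using D by blast
    then have "card (incident F w) < card D"
      using card_incident_less[OF F(1), of D w] incident_closed[OF D(3), of w] D(1) fW(1)
      by (simp add: finite_subset)
    then show ?thesis using fW(4)[of w] D(1) \<open>w \<in> D\<close> by auto
  qed
  have "closed_in F (W \<inter> C)" "closed_in F (W - C)"
    using F(2) fW(3) by (auto simp: closed_in_def)
  then have "k + 2 \<le> card (W \<inter> C)" "k + 2 \<le> card (W - C)"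
    using W \<open>\<not> W \<subseteq> C\<close> big[of "W \<inter> C"] big[of "W - C"] by blast+
  moreover have "card W = card (W \<inter> C) + card (W - C)"
    using fW(1) card_Int_Diff by blast
  ultimately show False using p fW(2) by simp
qed

text \<open>The whole component serves as \<open>X\<close>: no edge joins it to the rest, and a copy
  too small to split lies inside it as soon as it meets it.\<close>

lemma component_reducible:
  assumes E: "two_sets E" and comp: "C \<subseteq> U" "component (inner E U) C"
    and p: "p < 2 * (k + 2)"
    and game: "breaker_forces (\<lambda>M. M \<subseteq> inner E C \<and> no_copy p q (Suc k) M) {} (inner E C)"
  shows "reducible E p q (Suc k) U"
proof -
  have C: "C \<subseteq> U" "C \<noteq> {}" "closed_in (inner E U) C" using comp by (auto simp: component_def)
  have ne: "e \<noteq> {}" if "e \<in> E" for e using that E by (auto simp: two_sets_def)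
  have eq: "inner E U - inner E (U - C) = inner E C"
  proof (intro equalityI subsetI)
    fix e assume e: "e \<in> inner E U - inner E (U - C)"
    then have "e \<inter> C \<noteq> {}" by (auto simp: inner_def)
    then have "e \<subseteq> C" using e C(3) by (auto simp: closed_in_def)
    then show "e \<in> inner E C" using e by (auto simp: inner_def)
  next
    fix e assume e: "e \<in> inner E C"
    then have "e \<noteq> {}" "e \<subseteq> C" "e \<in> E" using ne by (auto simp: inner_def)
    then show "e \<in> inner E U - inner E (U - C)" using C(1) by (auto simp: inner_def)
  qed
  have "breaker_forces (\<lambda>M. M \<subseteq> inner E C \<and>
        (\<forall>W F. F \<subseteq> M \<union> inner E (U - C) \<longrightarrow> W \<inter> C \<noteq> {} \<longrightarrow> \<not> copy_on p q (Suc k) W F)) {} (inner E C)"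
  proof (rule breaker_forces_mono[OF game], intro conjI allI impI notI)
    fix M assume M: "M \<subseteq> inner E C \<and> no_copy p q (Suc k) M"
    then show "M \<subseteq> inner E C" by blast
    fix W F assume F: "F \<subseteq> M \<union> inner E (U - C)" and W: "W \<inter> C \<noteq> {}" and cp: "copy_on p q (Suc k) W F"
    have FE: "F \<subseteq> E" using F M inner_subset by blast
    have "closed_in F C" using F M C(1) unfolding closed_in_def inner_def by blast
    with cp W p have "W \<subseteq> C" using copy_on_closed two_sets_subset[OF E FE] by blast
    have "e \<notin> inner E (U - C)" if "e \<in> F" for e
    proof
      assume "e \<in> inner E (U - C)"
      then have "e \<noteq> {}" "e \<inter> C = {}" using ne by (auto simp: inner_def)
      moreover have "e \<subseteq> W" using that cp by (simp add: copy_on_def)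
      ultimately show False using \<open>W \<subseteq> C\<close> by blast
    qed
    then have "F \<subseteq> M" using F by blast
    then show False using M cp by (auto simp: no_copy_def)
  qed
  then show ?thesis unfolding reducible_def using C(1,2) eq by (intro exI[of _ C]) simp
qed

text \<open>Without \<open>r\<close> the component is 4-degenerate, so Maker's graph there is kept
  2-degenerate and spans at most 2 |W| - 3 edges. The strategy on the five edges at \<open>r\<close>
  is left open as \<open>Q\<close>, because the applications play differently there.\<close>

lemma breaker_forces_rooted:
  assumes E: "two_sets E" and U: "finite U" and C: "C \<subseteq> U" "component (inner E U) C"
    and deg: "\<And>x. x \<in> C \<Longrightarrow> card (incident (inner E U) x) = 5"
    and r: "r \<in> C"
    and root: "breaker_forces (\<lambda>M. M \<subseteq> incident (inner E C) r \<and> Q M) {} (incident (inner E C) r)"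
  shows "breaker_forces (\<lambda>M. M \<subseteq> inner E C \<and> Q (incident M r)
    \<and> (\<forall>W\<subseteq>C - {r}. 2 \<le> card W \<longrightarrow> card (inner M W) + 3 \<le> 2 * card W)) {} (inner E C)"
proof -
  have finC: "finite C" using C(1) U by (rule finite_subset)
  have inC: "inner (inner E U) U' = inner E U'" if "U' \<subseteq> C" for U' using that C(1) by (auto simp: inner_def)
  have deg': "\<exists>x\<in>U'. card (incident (inner E U') x) \<le> 2 * 2" if "U' \<subseteq> C - {r}" "U' \<noteq> {}" for U'
  proof -
    have "\<exists>x\<in>U'. card (incident (inner (inner E U) U') x) \<le> 4"
      using component_subset_degree[OF C(2) finite_inner[OF U], of 4 U'] deg that r by auto
    moreover have "inner (inner E U) U' = inner E U'" using that by (intro inC) auto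
    ultimately show ?thesis by simp
  qed
  have "finite (C - {r})" using finC by simp
  note rest = breaker_forces_degenerate[OF E this deg']
  show ?thesis
  proof (rule breaker_forces_split[OF root rest])
    show "inner E C \<subseteq> incident (inner E C) r \<union> inner E (C - {r})"
      using inner_remove_vertex[OF r, of E] by blast
    fix M1 M2 assume M1: "M1 \<subseteq> incident (inner E C) r \<and> Q M1"
      and M2: "M2 \<subseteq> inner E (C - {r}) \<and>
        (\<forall>W\<subseteq>C - {r}. W \<noteq> {} \<longrightarrow> (\<exists>w\<in>W. card (incident (inner M2 W) w) \<le> 2))"
    have "incident (M1 \<union> M2) r = M1" using M1 M2 by (auto simp: incident_def inner_def)
    moreover have "M1 \<union> M2 \<subseteq> inner E C" using M1 M2 by (auto simp: incident_def inner_def)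
    moreover have "card (inner (M1 \<union> M2) W) + 3 \<le> 2 * card W" if W: "W \<subseteq> C - {r}" "2 \<le> card W" for W
    proof -
      have "inner (M1 \<union> M2) W = inner M2 W" using M1 W by (auto simp: incident_def inner_def)
      moreover have "two_sets M2" using two_sets_subset[OF two_sets_inner[OF E] conjunct1[OF M2]] .
      moreover have "finite W" using W finC by (auto intro: finite_subset)
      moreover have "\<exists>w\<in>W'. card (incident (inner M2 W') w) \<le> 2" if "W' \<subseteq> W" "W' \<noteq> {}" for W'
        using conjunct2[OF M2] that order_trans[OF that(1) W(1)] by simp
      ultimately show ?thesis using degenerate_card_inner[of M2 W 2] W(2)
        by (simp add: numeral_2_eq_2 numeral_3_eq_3)
    qed
    ultimately show "M1 \<union> M2 \<subseteq> inner E C \<and> Q (incident (M1 \<union> M2) r)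
      \<and> (\<forall>W\<subseteq>C - {r}. 2 \<le> card W \<longrightarrow> card (inner (M1 \<union> M2) W) + 3 \<le> 2 * card W)"
      using M1 by simp
  qed
qed

text \<open>Halving at \<open>r\<close> suffices: a copy through \<open>r\<close> has at most 3 + (2
  5 - 3) = 10 edges, and one avoiding \<open>r\<close> at most 2 6 - 3 = 9.\<close>

lemma five_regular_6_11:
  assumes E: "two_sets E" and U: "finite U" and C: "C \<subseteq> U" "component (inner E U) C"
    and deg: "\<And>x. x \<in> C \<Longrightarrow> card (incident (inner E U) x) = 5"
  shows "breaker_forces (\<lambda>M. M \<subseteq> inner E C \<and> no_copy 6 11 3 M) {} (inner E C)"
proof -
  obtain r where r: "r \<in> C" using C(2) by (auto simp: component_def)
  have finC: "finite C" using C(1) U by (rule finite_subset)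
  have "inner (inner E U) C = inner E C" using C(1) by (auto simp: inner_def)
  then have "incident (inner E C) r = incident (inner E U) r"
    using incident_closed[of "inner E U" C r] C(2) r by (simp add: component_def)
  then have c: "card (incident (inner E C) r) \<le> 2 * 3" using deg[OF r] by simp
  have fin: "finite (incident (inner E C) r)" using finC by (simp add: finite_inner finite_incident)
  show ?thesis
  proof (rule breaker_forces_mono[OF breaker_forces_rooted[OF E U C deg r breaker_forces_half[OF fin c]]])
    fix M assume M: "M \<subseteq> inner E C \<and> card (incident M r) \<le> 3 \<and>
      (\<forall>W\<subseteq>C - {r}. 2 \<le> card W \<longrightarrow> card (inner M W) + 3 \<le> 2 * card W)"
    have "\<not> copy_on 6 11 3 W F" if F: "F \<subseteq> M" for W F
    proof
      assume cp: "copy_on 6 11 3 W F"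
      have finW: "finite W" "card W = 6" using cp by (auto simp: copy_on_def)
      have WC: "W \<subseteq> C" using copy_on_subset[OF cp] F M by auto
      have q: "11 \<le> card (inner M W)" using copy_on_card_le[OF cp F] .
      have rest: "card (inner M (W - {r})) + 3 \<le> 2 * card (W - {r})"
      proof -
        have "W - {r} \<subseteq> C - {r}" "2 \<le> card (W - {r})"
          using WC finW by (auto simp: card_Diff_singleton_if)
        then show ?thesis using M by blast
      qed
      show False
      proof (cases "r \<in> W")
        case True
        have "finite M" using M finC finite_inner finite_subset by metis
        then have "card (incident (inner M W) r) \<le> card (incident M r)"
          by (intro card_mono finite_incident) (auto simp: incident_def inner_def)
        moreover have "card (incident M r) \<le> 3" using M by blast
        moreover have "card (W - {r}) = 5" using True finW by simp
        ultimately show False using rest q card_inner_remove_vertex[OF finW(1) True, of M] by linarith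
      next
        case False
        then have "W - {r} = W" by simp
        then show False using rest q finW by simp
      qed
    qed
    then show "M \<subseteq> inner E C \<and> no_copy 6 11 3 M" using M by (simp add: no_copy_def)
  qed
qed

subsection \<open>The \<open>K\<^sub>4\<close>-game on 5-regular graphs\<close>

lemma breaker_forces_pairing:
  assumes "finite E" and "\<And>Q. Q \<in> \<P> \<Longrightarrow> card Q = 2"
    and disj: "pairwise disjnt \<P>"
  shows "breaker_forces (\<lambda>M. M \<subseteq> E \<and> (\<forall>Q\<in>\<P>. \<not> Q \<subseteq> M)) {} E"
proof -
  \<comment> \<open>By disjointness \<open>g e\<close> is the singleton of the pair containing
    \<open>e\<close>, or empty for an unpaired edge.\<close>
  define g where "g e = {Q\<in>\<P>. e \<in> Q}" for e
  have g: "g e = {Q}" if "Q \<in> \<P>" "e \<in> Q" for e Q using that disj by (auto simp: g_def pairwise_def disjnt_def)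
  show ?thesis
  proof (rule breaker_forces_mono[OF breaker_forces_groups[OF assms(1), of g]], intro conjI ballI notI)
    fix M assume M: "M \<subseteq> E \<and> (\<forall>i. 2 * card {e\<in>M. g e = i} \<le> card {e\<in>E. g e = i} + 1)"
    then show "M \<subseteq> E" by blast
    fix Q assume Q: "Q \<in> \<P>" "Q \<subseteq> M"
    have "{e\<in>M. g e = {Q}} = Q" "{e\<in>E. g e = {Q}} \<subseteq> Q"
      using g[OF Q(1)] Q(2) M by (auto simp: g_def)
    moreover have "card Q = 2" "finite Q" using assms(2)[OF Q(1)] by (auto intro: card_ge_0_finite)
    ultimately have "card {e\<in>M. g e = {Q}} = 2" "card {e\<in>E. g e = {Q}} \<le> 2"
      using card_mono by metis+
    moreover have "2 * card {e\<in>M. g e = {Q}} \<le> card {e\<in>E. g e = {Q}} + 1" using M by blast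
    ultimately show False by linarith
  qed
qed

lemma copy_on_complete:
  assumes "copy_on 4 6 d W F" "two_sets F" "x \<in> W" "y \<in> W" "x \<noteq> y"
  shows "{x, y} \<in> F"
proof -
  have W: "finite W" "card W = 4" "card F = 6" "\<forall>f\<in>F. f \<subseteq> W" using assms(1) by (auto simp: copy_on_def)
  have "F \<subseteq> {B. B \<subseteq> W \<and> card B = 2}" using W assms(2) by (auto simp: two_sets_def)
  moreover have "card {B. B \<subseteq> W \<and> card B = 2} = 6"
    using n_subsets[OF W(1), of 2] W(2) by (simp add: eval_nat_numeral)
  moreover have "finite {B. B \<subseteq> W \<and> card B = 2}" using W(1) by (auto intro: finite_subset[of _ "Pow W"])
  ultimately have "F = {B. B \<subseteq> W \<and> card B = 2}" using W(3) by (intro card_subset_eq) auto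
  then show ?thesis using assms(3-) by auto
qed

text \<open>Parts \<open>{a1, a2}\<close>, \<open>{b1, b2}\<close>, \<open>{c1, c2}\<close> are arranged cyclically, and every vertex pairs up its two
  edges to the preceding part. Four vertices always contain a full part together with a vertex of
  the following part.\<close>
lemma breaker_forces_six_vertices:
  assumes E: "two_sets E" and C: "finite C" "card C = 6"
  shows "breaker_forces (\<lambda>M. M \<subseteq> inner E C \<and> no_copy 4 6 3 M) {} (inner E C)"
proof -
  obtain xs where xs: "set xs = C" "distinct xs" using C(1) finite_distinct_list by blast
  then have "length xs = 6" using C(2) distinct_card by metis
  then obtain a1 a2 b1 b2 c1 c2 where xs_eq: "xs = [a1, a2, b1, b2, c1, c2]"
    by (auto simp: eval_nat_numeral length_Suc_conv)
  then have dist: "distinct [a1, a2, b1, b2, c1, c2]" and Ceq: "C = {a1, a2, b1, b2, c1, c2}" using xs by auto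
  have dist': "distinct [c2, c1, b2, b1, a2, a1]" using dist by auto
  define \<P> where "\<P> = {{{a1, b1}, {a2, b1}}, {{a1, b2}, {a2, b2}}, {{b1, c1}, {b2, c1}},
    {{b1, c2}, {b2, c2}}, {{c1, a1}, {c2, a1}}, {{c1, a2}, {c2, a2}}}"
  have pairs: "card Q = 2" if "Q \<in> \<P>" for Q
    using that dist by (auto simp: \<P>_def doubleton_eq_iff)
  have disj: "pairwise disjnt \<P>"
  proof -
    have "\<forall>Q\<in>\<P>. \<forall>Q'\<in>\<P>. Q = Q' \<or> disjnt Q Q'"
      using dist dist' by (simp add: \<P>_def disjnt_insert1 doubleton_eq_iff)
    then show ?thesis by (auto simp: pairwise_def)
  qed
  have fin: "finite (inner E C)" using C(1) by (rule finite_inner)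
  show ?thesis
  proof (rule breaker_forces_mono[OF breaker_forces_pairing[OF fin pairs disj]])
    fix M assume M: "M \<subseteq> inner E C \<and> (\<forall>Q\<in>\<P>. \<not> Q \<subseteq> M)"
    have "\<not> copy_on 4 6 3 W F" if F: "F \<subseteq> M" for W F
    proof
      assume cp: "copy_on 4 6 3 W F"
      have FE: "F \<subseteq> inner E C" using F M by blast
      have F2: "two_sets F" using two_sets_subset[OF two_sets_inner[OF E] FE] .
      have WC: "W \<subseteq> C" using copy_on_subset[OF cp FE] by simp
      have no: "\<not> (x \<in> W \<and> y \<in> W \<and> z \<in> W)"
        if "{{x, z}, {y, z}} \<in> \<P>" "x \<noteq> z" "y \<noteq> z" for x y z
      proof
        assume "x \<in> W \<and> y \<in> W \<and> z \<in> W"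
        then have "{x, z} \<in> F" "{y, z} \<in> F" using copy_on_complete[OF cp F2] that by auto
        then have "{{x, z}, {y, z}} \<subseteq> M" using F by auto
        then show False using that(1) M by blast
      qed
      have n: "\<not> (a1 \<in> W \<and> a2 \<in> W \<and> b1 \<in> W)" "\<not> (a1 \<in> W \<and> a2 \<in> W \<and> b2 \<in> W)"
        "\<not> (b1 \<in> W \<and> b2 \<in> W \<and> c1 \<in> W)" "\<not> (b1 \<in> W \<and> b2 \<in> W \<and> c2 \<in> W)"
        "\<not> (c1 \<in> W \<and> c2 \<in> W \<and> a1 \<in> W)" "\<not> (c1 \<in> W \<and> c2 \<in> W \<and> a2 \<in> W)"
        using dist dist' by (intro no; simp add: \<P>_def)+
      have "card W = (\<Sum>x\<in>C. if x \<in> W then 1 else 0)"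
        using WC C(1) by (simp add: sum.If_cases Int_absorb1)
      also have "\<dots> = (if a1 \<in> W then 1 else 0) + (if a2 \<in> W then 1 else 0) + (if b1 \<in> W then 1 else 0)
          + (if b2 \<in> W then 1 else 0) + (if c1 \<in> W then 1 else 0) + (if c2 \<in> W then 1 else 0)"
        using dist by (simp add: Ceq)
      finally have "card W \<noteq> 4" using n by (cases "a1 \<in> W"; cases "b1 \<in> W"; cases "c1 \<in> W"; simp split: if_splits)
      then show False using cp by (simp add: copy_on_def)
    qed
    then show "M \<subseteq> inner E C \<and> no_copy 4 6 3 M" using M by (simp add: no_copy_def)
  qed
qed

text \<open>If \<open>e\<close> had a neighbour \<open>u\<close> outside, counting forces N(e) = {r,
  u} + I and N(r) = {e, q} + I, where I is the set of three common neighbours of \<open>r\<close>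
  and \<open>e\<close>. Every vertex of I is then adjacent to all of r, e, u, q and has exactly one
  neighbour in I, so I would carry a perfect matching on three vertices.\<close>

lemma nbhd_subset_if_edges_in_three_triangles:
  assumes card5: "\<And>x. x \<in> C \<Longrightarrow> card (N x) = 5" and sub: "\<And>x. x \<in> C \<Longrightarrow> N x \<subseteq> C"
    and sym: "\<And>x y. y \<in> N x \<longleftrightarrow> x \<in> N y" and irr: "\<And>x. x \<notin> N x"
    and rich: "\<And>x y. x \<in> C \<Longrightarrow> y \<in> N x \<Longrightarrow> 3 \<le> card (N x \<inter> N y)"
    and r: "r \<in> C" and e: "e \<in> N r"
  shows "N e \<subseteq> insert r (N r)"
proof (rule ccontr)
  assume "\<not> ?thesis"
  then obtain u where u: "u \<in> N e" "u \<noteq> r" "u \<notin> N r" by blast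
  have fin: "finite (N x)" if "x \<in> C" for x using card5[OF that] by (auto intro: card_ge_0_finite)
  have eC: "e \<in> C" using sub[OF r] e by blast
  have uC: "u \<in> C" using sub[OF eC] u by blast
  define I where "I = N r \<inter> N e"
  have finI: "finite I" using fin[OF r] by (simp add: I_def)
  have I3: "3 \<le> card I" using rich[OF r e] by (simp add: I_def)
  have rNe: "r \<in> N e" using e sym by blast
  have nI: "r \<notin> I" "u \<notin> I" "e \<notin> I" using irr u by (auto simp: I_def)
  have subNe: "insert r (insert u I) \<subseteq> N e" using rNe u by (auto simp: I_def)
  have "card (insert r (insert u I)) = Suc (Suc (card I))" using finI nI u by simp
  then have cI: "card I = 3" using card_mono[OF fin[OF eC] subNe] card5[OF eC] I3 by simp
  have Ne: "N e = insert r (insert u I)"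
    using card_subset_eq[OF fin[OF eC] subNe] \<open>card (insert r (insert u I)) = _\<close> cI card5[OF eC] by simp
  have "card (insert e I) = 4" using finI nI cI by simp
  moreover have "insert e I \<subseteq> N r" using e by (auto simp: I_def)
  ultimately have "card (N r - insert e I) = 1"
    using card_Diff_subset[of "insert e I" "N r"] finI card5[OF r] by simp
  then obtain q where q: "N r - insert e I = {q}" by (auto simp: card_1_singleton_iff)
  then have q': "q \<in> N r" "q \<noteq> e" "q \<notin> I" "q \<notin> N e" by (auto simp: I_def)
  have Nr: "N r = insert e (insert q I)" using q e by (auto simp: I_def)
  have qC: "q \<in> C" using sub[OF r] q' by blast
  \<comment> \<open>The edge \<open>e u\<close> also lies in three triangles, and neither
    \<open>r\<close> nor \<open>u\<close> itself can be their third vertex.\<close>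
  have IsubNu: "I \<subseteq> N u"
  proof -
    have "N e \<inter> N u \<subseteq> I" using Ne irr[of u] u(3) sym by auto
    moreover have "3 \<le> card (N e \<inter> N u)" using rich[OF eC u(1)] .
    ultimately have "N e \<inter> N u = I" using cI finI by (intro card_seteq) auto
    then show ?thesis by blast
  qed
  have IsubNq: "I \<subseteq> N q"
  proof -
    have "N r \<inter> N q \<subseteq> I" using Nr irr[of q] q'(4) sym by auto
    moreover have "3 \<le> card (N r \<inter> N q)" using rich[OF r q'(1)] .
    ultimately have "N r \<inter> N q = I" using cI finI by (intro card_seteq) auto
    then show ?thesis by blast
  qed
  \<comment> \<open>At most one, because r, e, u, q already take four of the five neighbours of
    \<open>i\<close>; at least one, because \<open>r\<close> and \<open>i\<close> have three common
    neighbours and only \<open>e\<close> and \<open>q\<close> lie outside \<open>I\<close>.\<close>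
  have one: "card (N i \<inter> I) = 1" if i: "i \<in> I" for i
  proof -
    have iC: "i \<in> C" using i sub[OF r] by (auto simp: I_def)
    have in4: "{r, e, u, q} \<subseteq> N i" using i IsubNu IsubNq sym by (auto simp: I_def)
    have "r \<noteq> e" "r \<noteq> u" "r \<noteq> q" "e \<noteq> u" "e \<noteq> q" "u \<noteq> q"
      using u q' e irr[of r] irr[of e] by metis+
    then have c4: "card {r, e, u, q} = 4" by simp
    have "{r, e, u, q} \<inter> I = {}" using nI q' by auto
    then have "card ({r, e, u, q} \<union> (N i \<inter> I)) = 4 + card (N i \<inter> I)"
      using c4 finI by (subst card_Un_disjoint) auto
    moreover have "card ({r, e, u, q} \<union> (N i \<inter> I)) \<le> card (N i)"
      using in4 fin[OF iC] by (intro card_mono) auto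
    ultimately have le: "card (N i \<inter> I) \<le> 1" using card5[OF iC] by simp
    have "3 \<le> card (N r \<inter> N i)" using rich[OF r] i by (auto simp: I_def)
    also have "N r \<inter> N i \<subseteq> {e, q} \<union> (N i \<inter> I)" using Nr by auto
    then have "card (N r \<inter> N i) \<le> card ({e, q} \<union> (N i \<inter> I))" using finI by (intro card_mono) auto
    also have "\<dots> \<le> card {e, q} + card (N i \<inter> I)" by (rule card_Un_le)
    also have "card {e, q} \<le> 2" by (simp add: card_insert_if)
    finally show ?thesis using le by simp
  qed
  obtain i j l where I: "I = {i, j, l}" "i \<noteq> j" "i \<noteq> l" "j \<noteq> l" using cI by (auto simp: card_3_iff)
  have m: "(j \<in> N i) \<noteq> (l \<in> N i)" "(i \<in> N j) \<noteq> (l \<in> N j)" "(i \<in> N l) \<noteq> (j \<in> N l)"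
  proof -
    have "N i \<inter> I = (if j \<in> N i then {j} else {}) \<union> (if l \<in> N i then {l} else {})"
      "N j \<inter> I = (if i \<in> N j then {i} else {}) \<union> (if l \<in> N j then {l} else {})"
      "N l \<inter> I = (if i \<in> N l then {i} else {}) \<union> (if j \<in> N l then {j} else {})"
      using I irr by auto
    with one[of i] one[of j] one[of l] I show "(j \<in> N i) \<noteq> (l \<in> N i)"
      "(i \<in> N j) \<noteq> (l \<in> N j)" "(i \<in> N l) \<noteq> (j \<in> N l)" by (auto split: if_splits)
  qed
  then show False using sym by blast
qed

text \<open>If every edge lies in three triangles, a closed neighbourhood is closed and the
  component has six vertices. Otherwise some edge \<open>r e\<close> lies in at most two, and
  \<open>r\<close> is removed. The four other edges at \<open>r\<close> are paired so that of three
  neighbours of \<open>r\<close> in a copy one must be \<open>e\<close> and another one a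
  non-neighbour of \<open>e\<close>. A copy avoiding \<open>r\<close> would have at most 2 4 - 3 = 5
  edges.\<close>

lemma five_regular_4_6:
  assumes E: "two_sets E" and U: "finite U" and C: "C \<subseteq> U" "component (inner E U) C"
    and deg: "\<And>x. x \<in> C \<Longrightarrow> card (incident (inner E U) x) = 5"
  shows "breaker_forces (\<lambda>M. M \<subseteq> inner E C \<and> no_copy 4 6 3 M) {} (inner E C)"
proof -
  have finC: "finite C" using C(1) U by (rule finite_subset)
  have A2: "two_sets (inner E C)" using E by (rule two_sets_inner)
  have inC: "inner (inner E U) C = inner E C" using C(1) by (auto simp: inner_def)
  define N where "N x = nbrs (inner E C) x" for x
  have Ninc: "card (N x) = 5" if "x \<in> C" for x
  proof -
    have "incident (inner E C) x = incident (inner E U) x"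
      using incident_closed[of "inner E U" C x] C(2) that inC by (simp add: component_def)
    then show ?thesis using deg[OF that] card_incident_eq_nbrs[OF A2, of x] by (simp add: N_def)
  qed
  have NC: "N x \<subseteq> C" for x by (auto simp: N_def nbrs_def inner_def)
  have sym: "y \<in> N x \<longleftrightarrow> x \<in> N y" for x y by (simp add: N_def nbrs_sym)
  have irr: "x \<notin> N x" for x using nbrs_irrefl[OF A2] by (simp add: N_def)
  show ?thesis
  proof (cases "\<forall>x\<in>C. \<forall>y\<in>N x. 3 \<le> card (N x \<inter> N y)")
    case True
    have sub: "N e \<subseteq> insert r (N r)" if "r \<in> C" "e \<in> N r" for r e
      using nbhd_subset_if_edges_in_three_triangles[of C N r e] Ninc NC sym irr True that by blast
    obtain r where r: "r \<in> C" using C(2) by (auto simp: component_def)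
    have "closed_in (inner E U) (insert r (N r))"
      unfolding closed_in_def
    proof (intro ballI impI)
      fix e assume e: "e \<in> inner E U" "e \<inter> insert r (N r) \<noteq> {}"
      then obtain x where x: "x \<in> e" "x \<in> insert r (N r)" by blast
      have "card e = 2" using e E by (auto simp: inner_def two_sets_def)
      then obtain y where y: "e = {x, y}" using x by (meson two_set_cases)
      have "x \<in> C" using x r NC by blast
      then have "e \<subseteq> C" using e(1) C(2) x(1) by (auto simp: component_def closed_in_def)
      then have "y \<in> N x" using e(1) y by (auto simp: N_def nbrs_def inner_def)
      then have "y \<in> insert r (N r)" using x(2) sub[OF r] by blast
      then show "e \<subseteq> insert r (N r)" using x y by simp
    qed
    moreover have "insert r (N r) \<subseteq> C" using r NC by blast
    moreover have "\<not> closed_in (inner E U) C'" if "C' \<subset> C" "C' \<noteq> {}" for C'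
      using C(2) that unfolding component_def by simp
    ultimately have "C = insert r (N r)" by (metis insert_not_empty psubsetI)
    moreover have "card (insert r (N r)) = 6"
      using card_insert_disjoint[OF finite_subset[OF NC[of r] finC] irr[of r]] Ninc[OF r] by simp
    ultimately have "card C = 6" by (simp only:)
    then show ?thesis using breaker_forces_six_vertices[OF E finC] by simp
  next
    case False
    then obtain r e where r: "r \<in> C" and e: "e \<in> N r" and few: "card (N r \<inter> N e) \<le> 2" by force
    have finN: "finite (N r)" using finite_subset[OF NC finC] .
    have "card (N r - {e}) = 4" using Ninc[OF r] e finN by simp
    \<comment> \<open>All common neighbours of \<open>r\<close> and \<open>e\<close> go into
      \<open>P\<close>, padded to two vertices, so no vertex of the other pair \<open>R\<close> is
      adjacent to \<open>e\<close>.\<close>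
    moreover have "N r \<inter> N e \<subseteq> N r - {e}" using irr by auto
    ultimately obtain P where P: "N r \<inter> N e \<subseteq> P" "P \<subseteq> N r - {e}" "card P = 2"
      using exists_subset_between[of "N r \<inter> N e" 2 "N r - {e}"] few finN by auto
    define R where "R = N r - {e} - P"
    have finP: "finite P" using P finN by (auto intro: finite_subset)
    have cR: "card R = 2" unfolding R_def using P finP \<open>card (N r - {e}) = 4\<close>
      by (subst card_Diff_subset) auto
    define ed where "ed S = (\<lambda>y. {r, y}) ` S" for S
    have inj: "inj_on (\<lambda>y. {r, y}) S" for S by (auto simp: inj_on_def doubleton_eq_iff)
    have fin: "finite (incident (inner E C) r)" using finC by (simp add: finite_inner finite_incident)
    have root: "breaker_forces (\<lambda>M. M \<subseteq> incident (inner E C) r \<and> (\<forall>Q\<in>{ed P, ed R}. \<not> Q \<subseteq> M)) {} (incident (inner E C) r)"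
    proof (rule breaker_forces_pairing[OF fin])
      show "card Q = 2" if "Q \<in> {ed P, ed R}" for Q
        using that P(3) cR card_image[OF inj] by (auto simp: ed_def)
      have "ed P \<inter> ed R = {}" by (auto simp: ed_def R_def doubleton_eq_iff)
      then show "pairwise disjnt {ed P, ed R}" by (auto simp: pairwise_def disjnt_def)
    qed
    show ?thesis
    proof (rule breaker_forces_mono[OF breaker_forces_rooted[OF E U C deg r root]])
      fix M assume M: "M \<subseteq> inner E C \<and> (\<forall>Q\<in>{ed P, ed R}. \<not> Q \<subseteq> incident M r) \<and>
        (\<forall>W\<subseteq>C - {r}. 2 \<le> card W \<longrightarrow> card (inner M W) + 3 \<le> 2 * card W)"
      have "\<not> copy_on 4 6 3 W F" if F: "F \<subseteq> M" for W F
      proof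
        assume cp: "copy_on 4 6 3 W F"
        have finW: "finite W" "card W = 4" using cp by (auto simp: copy_on_def)
        have FE: "F \<subseteq> inner E C" using F M by blast
        have F2: "two_sets F" using two_sets_subset[OF A2 FE] .
        have WC: "W \<subseteq> C" using copy_on_subset[OF cp FE] by simp
        have q: "6 \<le> card (inner M W)" using copy_on_card_le[OF cp F] .
        have rW: "r \<in> W"
        proof (rule ccontr)
          assume "r \<notin> W"
          then have "W \<subseteq> C - {r}" using WC by blast
          moreover have "2 \<le> card W" using finW by simp
          ultimately have "card (inner M W) + 3 \<le> 2 * card W" using M by blast
          then show False using q finW by simp
        qed
        define T where "T = W - {r}"
        have cT: "card T = 3" "finite T" using rW finW by (auto simp: T_def)
        have edge: "{x, y} \<in> F" if "x \<in> W" "y \<in> W" "x \<noteq> y" for x y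
          using copy_on_complete[OF cp F2 that] .
        have TN: "T \<subseteq> N r" using edge rW FE by (auto simp: T_def N_def nbrs_def)
        have half: "\<not> S \<subseteq> T" if S: "ed S \<in> {ed P, ed R}" for S
        proof
          assume "S \<subseteq> T"
          then have "ed S \<subseteq> incident M r" using edge rW F by (auto simp: ed_def T_def incident_def)
          then show False using M S by blast
        qed
        have dec: "T = (T \<inter> {e}) \<union> (T \<inter> P) \<union> (T \<inter> R)" using TN by (auto simp: R_def)
        have lt: "card (T \<inter> S) \<le> 1" if "card S = 2" "\<not> S \<subseteq> T" for S
        proof -
          have "finite S" using that(1) by (auto intro: card_ge_0_finite)
          then have "card (T \<inter> S) < card S" using that(2) by (intro psubset_card_mono) auto
          then show ?thesis using that(1) by simp
        qed
        have "card (T \<inter> P) \<le> 1" "card (T \<inter> R) \<le> 1" using lt P(3) cR half by auto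
        moreover have "card T \<le> card (T \<inter> {e}) + card (T \<inter> P) + card (T \<inter> R)"
          by (subst dec) (meson add_le_mono card_Un_le order_refl order_trans)
        moreover have "card (T \<inter> {e}) \<le> (if e \<in> T then 1 else 0)" by auto
        ultimately have "e \<in> T" "card (T \<inter> R) \<noteq> 0" using cT by (auto split: if_splits)
        then obtain y where y: "y \<in> T" "y \<in> R" by (metis card.empty disjoint_iff)
        then have "{e, y} \<in> F" using edge \<open>e \<in> T\<close> by (auto simp: T_def R_def)
        then have "y \<in> N e" using FE by (auto simp: N_def nbrs_def)
        then show False using y(2) P(1) by (auto simp: R_def)
      qed
      then show "M \<subseteq> inner E C \<and> no_copy 4 6 3 M" using M by (simp add: no_copy_def)
    qed
  qed
qed

subsection \<open>The \<open>C\<^sub>4\<close>-game on cubic graphs\<close>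

lemma forest_card:
  assumes "two_sets M" "finite W" "W \<noteq> {}" "W \<subseteq> U"
    and "\<forall>W\<subseteq>U. W \<noteq> {} \<longrightarrow> (\<exists>w\<in>W. card (incident (inner M W) w) \<le> 1)"
  shows "card (inner M W) < card W"
proof -
  have "1 \<le> card W" using assms(2,3) by (simp add: Suc_leI card_gt_0_iff)
  moreover have "\<exists>w\<in>W'. card (incident (inner M W') w) \<le> 1" if "W' \<subseteq> W" "W' \<noteq> {}" for W'
    using assms(5) that order_trans[OF that(1) assms(4)] by simp
  ultimately have "card (inner M W) + (Suc 1 choose 2) \<le> 1 * card W"
    by (intro degenerate_card_inner[OF assms(1,2)])
  then show ?thesis by (simp add: numeral_2_eq_2)
qed

text \<open>Both sides of the bridge are proper subsets of the component, hence 2-degenerate, and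
  Breaker keeps Maker's edges on each side a forest. The bridge can be conceded, as it creates no
  cycle. Being a forest is expressed by counting: fewer edges than vertices on every nonempty
  set.\<close>

lemma cubic_with_bridge:
  assumes A: "finite A" "two_sets A" and C: "finite C" "component A C"
    and deg: "\<And>x. x \<in> C \<Longrightarrow> card (incident A x) = 3"
    and S: "S \<subset> C" "S \<noteq> {}" and f: "f \<inter> S \<noteq> {}" "\<not> f \<subseteq> S"
    and bridge: "\<And>e. e \<in> A \<Longrightarrow> e \<inter> S \<noteq> {} \<Longrightarrow> \<not> e \<subseteq> S \<Longrightarrow> e = f"
  shows "breaker_forces (\<lambda>M. M \<subseteq> inner A C \<and> no_copy 4 4 2 M) {} (inner A C)"
proof (cases "f \<in> A")
  case False
  then have "closed_in A S" using bridge by (auto simp: closed_in_def)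
  then show ?thesis using C(2) S by (auto simp: component_def)
next
  case True
  have fC: "f \<in> inner A C"
    using True C(2) f(1) S(1) by (auto simp: component_def closed_in_def inner_def)
  have sub: "\<exists>x\<in>U'. card (incident (inner A U') x) \<le> 2 * 1" if "U' \<subset> C" "U' \<noteq> {}" for U'
  proof -
    have "card (incident A x) \<le> Suc 2" if "x \<in> C" for x using deg[OF that] by simp
    from component_subset_degree[OF C(2) A(1) this \<open>U' \<subset> C\<close> \<open>U' \<noteq> {}\<close>] show ?thesis by simp
  qed
  have "\<exists>x\<in>U'. card (incident (inner A U') x) \<le> 2 * 1" if "U' \<subseteq> S" "U' \<noteq> {}" for U'
    using sub[of U'] that S(1) by blast
  moreover have finS: "finite S" using S(1) C(1) by (auto intro: finite_subset)
  ultimately have g1: "breaker_forces (\<lambda>M. M \<subseteq> inner A S \<and>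
    (\<forall>W\<subseteq>S. W \<noteq> {} \<longrightarrow> (\<exists>w\<in>W. card (incident (inner M W) w) \<le> 1))) {} (inner A S)"
    by (intro breaker_forces_degenerate[OF A(2)])
  have "\<exists>x\<in>U'. card (incident (inner A U') x) \<le> 2 * 1" if "U' \<subseteq> C - S" "U' \<noteq> {}" for U'
    using sub[of U'] that S by blast
  moreover have "finite (C - S)" using C(1) by simp
  ultimately have g2: "breaker_forces (\<lambda>M. M \<subseteq> inner A (C - S) \<and>
    (\<forall>W\<subseteq>C - S. W \<noteq> {} \<longrightarrow> (\<exists>w\<in>W. card (incident (inner M W) w) \<le> 1))) {} (inner A (C - S))"
    by (intro breaker_forces_degenerate[OF A(2)])
  define T where "T M \<longleftrightarrow> M \<subseteq> inner A S \<union> inner A (C - S) \<and>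
    (\<forall>W\<subseteq>S. W \<noteq> {} \<longrightarrow> card (inner M W) < card W) \<and>
    (\<forall>W\<subseteq>C - S. W \<noteq> {} \<longrightarrow> card (inner M W) < card W)" for M
  have disj: "inner M W = {}" if "M \<subseteq> inner A Y" "W \<inter> Y = {}" for M W Y
  proof -
    have "e \<notin> M" if "e \<subseteq> W" for e
    proof
      assume "e \<in> M"
      then have "e \<in> A" "e \<subseteq> Y" using \<open>M \<subseteq> inner A Y\<close> by (auto simp: inner_def)
      then have "e = {}" using that \<open>W \<inter> Y = {}\<close> by blast
      then show False using \<open>e \<in> A\<close> A(2) by (auto simp: two_sets_def)
    qed
    then show ?thesis by (auto simp: inner_def)
  qed
  have inU: "inner (M1 \<union> M2) W = inner M1 W \<union> inner M2 W" for M1 M2 :: "'a set set" and W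
    by (auto simp: inner_def)
  have g12: "breaker_forces T {} (inner A S \<union> inner A (C - S))"
  proof (rule breaker_forces_split[OF g1 g2 order_refl])
    fix M1 M2 assume M1: "M1 \<subseteq> inner A S \<and> (\<forall>W\<subseteq>S. W \<noteq> {} \<longrightarrow> (\<exists>w\<in>W. card (incident (inner M1 W) w) \<le> 1))"
      and M2: "M2 \<subseteq> inner A (C - S) \<and> (\<forall>W\<subseteq>C - S. W \<noteq> {} \<longrightarrow> (\<exists>w\<in>W. card (incident (inner M2 W) w) \<le> 1))"
    have ts: "two_sets M1" "two_sets M2"
      by (rule two_sets_subset[OF two_sets_inner[OF A(2)] conjunct1[OF M1]],
          rule two_sets_subset[OF two_sets_inner[OF A(2)] conjunct1[OF M2]])
    have "card (inner (M1 \<union> M2) W) < card W" if "W \<subseteq> S" "W \<noteq> {}" for W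
    proof -
      have "inner M2 W = {}" using M2 that by (intro disj[of _ "C - S"]) auto
      then have "inner (M1 \<union> M2) W = inner M1 W" by (simp add: inU)
      moreover have "finite W" using that(1) finS by (rule finite_subset)
      ultimately show ?thesis using forest_card[OF ts(1) _ that(2,1) conjunct2[OF M1]] by simp
    qed
    moreover have "card (inner (M1 \<union> M2) W) < card W" if "W \<subseteq> C - S" "W \<noteq> {}" for W
    proof -
      have "inner M1 W = {}" using M1 that by (intro disj[of _ S]) auto
      then have "inner (M1 \<union> M2) W = inner M2 W" by (simp add: inU)
      moreover have "finite W" using that(1) C(1) by (meson finite_Diff finite_subset)
      ultimately show ?thesis using forest_card[OF ts(2) _ that(2,1) conjunct2[OF M2]] by simp
    qed
    ultimately show "T (M1 \<union> M2)" using M1 M2 unfolding T_def by blast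
  qed
  show ?thesis
  proof (rule breaker_forces_split[OF g12 breaker_forces_any[of "{f}"]])
    show "inner A C \<subseteq> inner A S \<union> inner A (C - S) \<union> {f}"
    proof
      fix e assume e: "e \<in> inner A C"
      then have "e \<subseteq> S \<or> e \<inter> S = {} \<or> e = f" using bridge[of e] by (auto simp: inner_def)
      then show "e \<in> inner A S \<union> inner A (C - S) \<union> {f}" using e by (auto simp: inner_def)
    qed
    fix M M3 assume M: "T M" and M3: "M3 \<subseteq> {f}"
    have Msub: "M \<subseteq> inner A S \<union> inner A (C - S)" using M unfolding T_def by (rule conjunct1)
    moreover have "inner A S \<union> inner A (C - S) \<subseteq> inner A C" using S(1) by (auto simp: inner_def)
    ultimately have MC: "M \<union> M3 \<subseteq> inner A C" using M3 fC by blast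
    have "\<not> copy_on 4 4 2 W F" if F: "F \<subseteq> M \<union> M3" for W F
    proof
      assume cp: "copy_on 4 4 2 W F"
      have W: "finite W" "card W = 4" using cp by (auto simp: copy_on_def)
      have WC: "W \<subseteq> C" using copy_on_subset[OF cp order_trans[OF F MC]] by simp
      have q: "4 \<le> card (inner (M \<union> M3) W)" using copy_on_card_le[OF cp F] .
      have M1: "card (inner M W') < card W'" if "W' \<subseteq> S" "W' \<noteq> {}" for W'
        using M that unfolding T_def by blast
      have M2: "card (inner M W') < card W'" if "W' \<subseteq> C - S" "W' \<noteq> {}" for W'
        using M that unfolding T_def by blast
      have "W \<noteq> {}" using W by auto
      consider "W \<subseteq> S" | "W \<subseteq> C - S" | "W \<inter> S \<noteq> {}" "W - S \<noteq> {}" using WC by blast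
      then show False
      proof cases
        case 1
        then have "inner M3 W = {}" using M3 f by (auto simp: inner_def)
        then show False using M1[OF 1 \<open>W \<noteq> {}\<close>] q W by (simp add: inU)
      next
        case 2
        then have "inner M3 W = {}" using M3 f by (auto simp: inner_def)
        then show False using M2[OF 2 \<open>W \<noteq> {}\<close>] q W by (simp add: inU)
      next
        case 3
        have "inner (M \<union> M3) W \<subseteq> inner M (W \<inter> S) \<union> inner M (W - S) \<union> {f}"
          using Msub M3 by (auto simp: inner_def)
        then have "card (inner (M \<union> M3) W) \<le> card (inner M (W \<inter> S) \<union> inner M (W - S) \<union> {f})"
          using W(1) by (intro card_mono) (auto intro: finite_inner)
        also have "\<dots> \<le> card (inner M (W \<inter> S)) + card (inner M (W - S)) + card {f}"
          by (meson add_le_mono card_Un_le order_refl order_trans)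
        finally have "card (inner (M \<union> M3) W) \<le> card (inner M (W \<inter> S)) + card (inner M (W - S)) + 1" by simp
        moreover have "card (inner M (W \<inter> S)) < card (W \<inter> S)" using 3 by (intro M1) auto
        moreover have "card (inner M (W - S)) < card (W - S)" using 3 WC by (intro M2) auto
        moreover have "card W = card (W \<inter> S) + card (W - S)" using W(1) card_Int_Diff by blast
        ultimately show False using q W by linarith
      qed
    qed
    then show "M \<union> M3 \<subseteq> inner A C \<and> no_copy 4 4 2 (M \<union> M3)" using MC by (simp add: no_copy_def)
  qed simp
qed

text \<open>After Maker's first edge \<open>{u, v}\<close> and Breaker's reply \<open>{u, w}\<close>, the vertices \<open>u\<close> and \<open>v\<close> are eliminated
  together, as if the first edge had been contracted.\<close>
lemma cubic_after_first_round:
  assumes A: "finite A" "two_sets A" and C: "finite C" "component A C"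
    and deg: "\<And>x. x \<in> C \<Longrightarrow> card (incident A x) = 3"
    and uv: "{u, v} \<in> A" "u \<noteq> v" "u \<in> C" and uw: "{u, w} \<in> A" "w \<noteq> u" "w \<noteq> v"
    and no_bridge: "\<And>S f. S \<subset> C \<Longrightarrow> S \<noteq> {} \<Longrightarrow> f \<inter> S \<noteq> {} \<Longrightarrow> \<not> f \<subseteq> S \<Longrightarrow>
      \<exists>e\<in>A. e \<inter> S \<noteq> {} \<and> \<not> e \<subseteq> S \<and> e \<noteq> f"
    and B: "B = A - {{u, v}, {u, w}}"
    and U: "U \<subseteq> C" "u \<in> U \<longleftrightarrow> v \<in> U"
  shows "breaker_forces (\<lambda>M. M \<subseteq> inner B U \<and>
    (\<forall>W\<subseteq>U. W \<noteq> {} \<longrightarrow> card (inner (insert {u, v} M) W) < card W)) {} (inner B U)"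
  using finite_subset[OF U(1) C(1)] U
proof (induction rule: finite_psubset_induct)
  case (psubset U)
  have closedC: "closed_in A C" and minC: "\<And>C'. C' \<subset> C \<Longrightarrow> C' \<noteq> {} \<Longrightarrow> \<not> closed_in A C'"
    using C(2) unfolding component_def by simp_all
  have vC: "v \<in> C" using closedC uv by (auto simp: closed_in_def)
  have wC: "w \<in> C" using closedC uw uv(3) by (auto simp: closed_in_def)
  have B2: "two_sets B" using two_sets_subset[OF A(2)] B by blast
  have finB: "finite (inner B U)" using psubset.hyps by (rule finite_inner)
  show ?case
  proof (cases "U = {}")
    case True
    then have "inner B U = {}" using B2 by (auto simp: inner_def two_sets_def)
    then show ?thesis using True by (auto intro!: breaker_forces.breaker_forcesI)
  next
    case False
    define D where "D = {e\<in>inner B U. u \<in> e \<or> v \<in> e}"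
    \<comment> \<open>Suppose neither holds. Then all vertices of \<open>U\<close> other than
      \<open>u\<close> and \<open>v\<close> keep their three edges inside \<open>U\<close>, so
      \<open>w\<close>, which lost \<open>{u, w}\<close>, is not in \<open>U\<close>. If
      \<open>u\<close> is not in \<open>U\<close>, then \<open>U\<close> is closed, against
      minimality of \<open>C\<close>. If it is, the remaining edges at \<open>u\<close> and
      \<open>v\<close> stay inside too, and \<open>{u, w}\<close> is the only edge leaving
      \<open>U\<close>, a bridge.\<close>
    have choice: "(\<exists>x\<in>U - {u, v}. card (incident (inner B U) x) \<le> 2) \<or> u \<in> U \<and> card D \<le> 2"
    proof (rule ccontr)
      assume neg: "\<not> ?thesis"
      have all: "e \<in> inner B U" if "x \<in> U - {u, v}" "e \<in> A" "x \<in> e" for x e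
      proof -
        have "3 \<le> card (incident (inner B U) x)" using neg that(1) by force
        moreover have "incident (inner B U) x \<subseteq> incident A x" by (auto simp: incident_def inner_def B)
        moreover have "card (incident A x) = 3" using deg that(1) psubset.prems(1) by blast
        ultimately have "incident (inner B U) x = incident A x"
          using finite_incident[OF A(1)] by (intro card_seteq) auto
        then show ?thesis using that by (auto simp: incident_def)
      qed
      have wU: "w \<notin> U"
      proof
        assume "w \<in> U"
        then have "{u, w} \<in> inner B U" using uw by (intro all[of w]) auto
        then show False by (simp add: inner_def B)
      qed
      have UC: "U \<subset> C" using psubset.prems(1) wU wC by blast
      show False
      proof (cases "u \<in> U")
        case False
        then have "v \<notin> U" using psubset.prems(2) by simp
        then have "closed_in A U" unfolding closed_in_def
        proof (intro ballI impI)
          fix e assume e: "e \<in> A" "e \<inter> U \<noteq> {}"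
          then obtain x where "x \<in> e" "x \<in> U" by blast
          then have "e \<in> inner B U" using e(1) False \<open>v \<notin> U\<close> by (intro all[of x]) auto
          then show "e \<subseteq> U" by (simp add: inner_def)
        qed
        then show False using minC[OF UC \<open>U \<noteq> {}\<close>] by simp
      next
        case True
        then have vU: "v \<in> U" using psubset.prems(2) by simp
        have D3: "3 \<le> card D" using neg True by force
        \<comment> \<open>Two of the three edges at \<open>u\<close> are gone and one of those at
          \<open>v\<close>, so \<open>R\<close> has at most 1 + 2 edges and \<open>D\<close> must be
          all of it.\<close>
        define R where "R = (incident A u - {{u, v}, {u, w}}) \<union> (incident A v - {{u, v}})"
        have "D \<subseteq> R"
          using uv(2) by (auto simp: D_def R_def inner_def incident_def B)
        moreover have "card R \<le> 3"
        proof -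
          have "{u, v} \<noteq> {u, w}" using uw(3) by (auto simp: doubleton_eq_iff)
          then have "card (incident A u - {{u, v}, {u, w}}) = 1"
            using deg[OF uv(3)] uv uw by (subst card_Diff_subset) (auto simp: incident_def)
          moreover have "card (incident A v - {{u, v}}) = 2"
            using deg[OF vC] uv by (subst card_Diff_subset) (auto simp: incident_def)
          ultimately show ?thesis unfolding R_def using card_Un_le
            by (metis one_plus_numeral semiring_norm(3))
        qed
        moreover have "finite R" using A(1) by (auto simp: R_def finite_incident)
        ultimately have DR: "D = R" using D3 by (intro card_seteq) auto
        have only: "e = {u, w}" if e: "e \<in> A" "e \<inter> U \<noteq> {}" "\<not> e \<subseteq> U" for e
        proof (rule ccontr)
          assume ne: "e \<noteq> {u, w}"
          obtain x where x: "x \<in> e" "x \<in> U" using e(2) by blast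
          have "e \<notin> inner B U" using e(3) by (simp add: inner_def)
          then have "x \<in> {u, v}" using all[of x e] x e(1) by blast
          moreover have "e \<noteq> {u, v}" using e(3) True vU by blast
          ultimately have "e \<in> R" using x e(1) ne by (auto simp: R_def incident_def)
          then have "e \<in> inner B U" using DR by (auto simp: D_def)
          then show False using \<open>e \<notin> inner B U\<close> by simp
        qed
        have "{u, w} \<inter> U \<noteq> {}" "\<not> {u, w} \<subseteq> U" using True wU by auto
        from no_bridge[OF UC \<open>U \<noteq> {}\<close> this] only show False by blast
      qed
    qed
    have inM: "inner M W \<subseteq> inner B Y" if "M \<subseteq> inner B Y" for M W Y using that by (auto simp: inner_def)
    from choice show ?thesis
    proof
      assume "\<exists>x\<in>U - {u, v}. card (incident (inner B U) x) \<le> 2"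
      then obtain x where x: "x \<in> U" "x \<noteq> u" "x \<noteq> v" "card (incident (inner B U) x) \<le> 2 * 1" by auto
      have fin: "finite (incident (inner B U) x)" using finB by (rule finite_incident)
      have IH: "breaker_forces (\<lambda>M. M \<subseteq> inner B (U - {x}) \<and>
        (\<forall>W\<subseteq>U - {x}. W \<noteq> {} \<longrightarrow> card (inner (insert {u, v} M) W) < card W)) {} (inner B (U - {x}))"
      proof (rule psubset.IH)
        show "U - {x} \<subset> U" using x(1) by blast
        show "U - {x} \<subseteq> C" using psubset.prems(1) by blast
        show "u \<in> U - {x} \<longleftrightarrow> v \<in> U - {x}" using psubset.prems(2) x by simp
      qed
      show ?thesis
      proof (rule breaker_forces_split[OF breaker_forces_half[OF fin x(4)] IH])
        show "inner B U \<subseteq> incident (inner B U) x \<union> inner B (U - {x})"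
          using inner_remove_vertex[OF x(1), of B] by blast
        fix M1 M2 assume M1: "M1 \<subseteq> incident (inner B U) x \<and> card M1 \<le> 1"
          and M2: "M2 \<subseteq> inner B (U - {x}) \<and>
            (\<forall>W\<subseteq>U - {x}. W \<noteq> {} \<longrightarrow> card (inner (insert {u, v} M2) W) < card W)"
        have sub: "M1 \<union> M2 \<subseteq> inner B U" using M1 M2 by (auto simp: incident_def inner_def)
        have finM1: "finite M1" using M1 fin by (auto intro: finite_subset)
        have M2': "card (inner (insert {u, v} M2) W) < card W" if "W \<subseteq> U - {x}" "W \<noteq> {}" for W
          using M2 that by blast
        have "card (inner (insert {u, v} (M1 \<union> M2)) W) < card W" if W: "W \<subseteq> U" "W \<noteq> {}" for W
        proof -
          have finW: "finite W" using W(1) psubset.hyps by (rule finite_subset)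
          have out: "inner (insert {u, v} (M1 \<union> M2)) W' = inner (insert {u, v} M2) W'" if "x \<notin> W'" for W'
            using that M1 by (auto simp: inner_def incident_def)
          show ?thesis
          proof (cases "x \<in> W")
            case False
            then show ?thesis using out[of W] M2'[of W] W by auto
          next
            case True
            have "incident (inner (insert {u, v} (M1 \<union> M2)) W) x \<subseteq> M1"
              using M2 x(2,3) by (auto simp: incident_def inner_def)
            then have "card (incident (inner (insert {u, v} (M1 \<union> M2)) W) x) \<le> card M1"
              using finM1 by (intro card_mono)
            then have le: "card (inner (insert {u, v} (M1 \<union> M2)) W)
                \<le> card (inner (insert {u, v} M2) (W - {x})) + 1"
              using card_inner_remove_vertex[OF finW True, of "insert {u, v} (M1 \<union> M2)"] M1 out[of "W - {x}"] by simp
            show ?thesis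
            proof (cases "W = {x}")
              case True
              have "two_sets (insert {u, v} (M1 \<union> M2))"
                using sub uv(1) A(2) by (auto simp: two_sets_def inner_def B)
              from card_inner_le_choose[OF finW this] True show ?thesis by (simp add: numeral_2_eq_2)
            next
              case False
              then have "card (inner (insert {u, v} M2) (W - {x})) < card (W - {x})"
                using W True by (intro M2') auto
              moreover have "card W = Suc (card (W - {x}))" using True finW by (metis card_Suc_Diff1)
              ultimately show ?thesis using le by linarith
            qed
          qed
        qed
        then show "M1 \<union> M2 \<subseteq> inner B U \<and>
          (\<forall>W\<subseteq>U. W \<noteq> {} \<longrightarrow> card (inner (insert {u, v} (M1 \<union> M2)) W) < card W)"
          using sub by simp
      qed
    next
      assume u: "u \<in> U \<and> card D \<le> 2"
      then have vU: "v \<in> U" using psubset.prems(2) by simp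
      have fin: "finite D" using finB by (simp add: D_def)
      have IH: "breaker_forces (\<lambda>M. M \<subseteq> inner B (U - {u, v}) \<and>
        (\<forall>W\<subseteq>U - {u, v}. W \<noteq> {} \<longrightarrow> card (inner (insert {u, v} M) W) < card W)) {} (inner B (U - {u, v}))"
      proof (rule psubset.IH)
        show "U - {u, v} \<subset> U" using u by blast
        show "U - {u, v} \<subseteq> C" using psubset.prems(1) by blast
      qed simp
      have D2: "card D \<le> 2 * 1" using u by simp
      show ?thesis
      proof (rule breaker_forces_split[OF breaker_forces_half[OF fin D2] IH])
        show "inner B U \<subseteq> D \<union> inner B (U - {u, v})" by (auto simp: D_def inner_def)
        fix M1 M2 assume M1: "M1 \<subseteq> D \<and> card M1 \<le> 1"
          and M2: "M2 \<subseteq> inner B (U - {u, v}) \<and>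
            (\<forall>W\<subseteq>U - {u, v}. W \<noteq> {} \<longrightarrow> card (inner (insert {u, v} M2) W) < card W)"
        have sub: "M1 \<union> M2 \<subseteq> inner B U" using M1 M2 by (auto simp: D_def inner_def)
        have finM1: "finite M1" using M1 fin by (auto intro: finite_subset)
        have M2': "card (inner (insert {u, v} M2) W) < card W" if "W \<subseteq> U - {u, v}" "W \<noteq> {}" for W
          using M2 that by blast
        have "card (inner (insert {u, v} (M1 \<union> M2)) W) < card W" if W: "W \<subseteq> U" "W \<noteq> {}" for W
        proof -
          have finW: "finite W" using W(1) psubset.hyps by (rule finite_subset)
          define W0 where "W0 = W - {u, v}"
          have ts: "two_sets (insert {u, v} (M1 \<union> M2))"
            using sub uv(1) A(2) by (auto simp: two_sets_def inner_def B)
          show ?thesis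
          proof (cases "W0 = {}")
            case True
            then have "W = {u} \<or> W = {v} \<or> W = {u, v}" using W(2) by (auto simp: W0_def)
            then have "card W choose 2 < card W" using uv(2) by (elim disjE) (simp_all add: numeral_2_eq_2)
            then show ?thesis using card_inner_le_choose[OF finW ts] by simp
          next
            case False
            have lt: "card (inner (insert {u, v} M2) W0) < card W0"
              using W False by (intro M2') (auto simp: W0_def)
            \<comment> \<open>Adding vertices of \<open>{u, v}\<close> to \<open>W0\<close> brings
              at most one edge from \<open>D\<close>, and \<open>{u, v}\<close> only when both are
              added, so never more edges than vertices are gained.\<close>
            define f where "f = (if u \<in> W \<and> v \<in> W then {{u, v}} else {})"
            define g where "g = (if u \<in> W \<or> v \<in> W then M1 else {})"
            have "inner (insert {u, v} (M1 \<union> M2)) W \<subseteq> inner (insert {u, v} M2) W0 \<union> g \<union> f"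
            proof
              fix e assume e: "e \<in> inner (insert {u, v} (M1 \<union> M2)) W"
              then have "e \<subseteq> W" "e = {u, v} \<or> e \<in> M1 \<or> e \<in> M2" by (auto simp: inner_def)
              then consider "e = {u, v}" | "e \<in> M1" | "e \<in> M2" by blast
              then show "e \<in> inner (insert {u, v} M2) W0 \<union> g \<union> f"
              proof cases
                case 1 then show ?thesis using \<open>e \<subseteq> W\<close> by (simp add: f_def)
              next
                case 2
                then have "u \<in> W \<or> v \<in> W" using M1 \<open>e \<subseteq> W\<close> by (auto simp: D_def)
                then show ?thesis using 2 by (simp add: g_def)
              next
                case 3
                then have "e \<subseteq> W0" using conjunct1[OF M2] \<open>e \<subseteq> W\<close> by (auto simp: W0_def inner_def)
                then show ?thesis using 3 by (simp add: inner_def)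
              qed
            qed
            then have "card (inner (insert {u, v} (M1 \<union> M2)) W) \<le> card (inner (insert {u, v} M2) W0 \<union> g \<union> f)"
              using finW finM1 by (intro card_mono) (auto simp: W0_def f_def g_def finite_inner)
            also have "\<dots> \<le> card (inner (insert {u, v} M2) W0) + card g + card f"
              by (meson add_le_mono card_Un_le order_refl order_trans)
            finally have le: "card (inner (insert {u, v} (M1 \<union> M2)) W)
              \<le> card (inner (insert {u, v} M2) W0) + card g + card f" .
            have "card g + card f + card W0 \<le> card W"
            proof -
              have "card W = card W0 + card (W \<inter> {u, v})"
                unfolding W0_def using card_Int_Diff[OF finW, of "{u, v}"] by simp
              moreover have "card g + card f \<le> card (W \<inter> {u, v})"
                using M1 uv(2) by (cases "u \<in> W"; cases "v \<in> W") (auto simp: f_def g_def)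
              ultimately show ?thesis by linarith
            qed
            then show ?thesis using le lt by linarith
          qed
        qed
        then show "M1 \<union> M2 \<subseteq> inner B U \<and>
          (\<forall>W\<subseteq>U. W \<noteq> {} \<longrightarrow> card (inner (insert {u, v} (M1 \<union> M2)) W) < card W)"
          using sub by simp
      qed
    qed
  qed
qed

text \<open>Removing one vertex and halving its three edges would allow 2 + 2 = 4 edges on four
  vertices, one too many. A bridge avoids this loss; without one, Breaker's first reply creates the
  missing deficit. A bridge is described by a proper part \<open>S\<close> of \<open>C\<close> left
  by no edge except possibly \<open>f\<close>.\<close>

lemma cubic_4_4:
  assumes A: "finite A" "two_sets A" and C: "finite C" "component A C"
    and deg: "\<And>x. x \<in> C \<Longrightarrow> card (incident A x) = 3"
  shows "breaker_forces (\<lambda>M. M \<subseteq> inner A C \<and> no_copy 4 4 2 M) {} (inner A C)"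
proof (cases "\<exists>S f. S \<subset> C \<and> S \<noteq> {} \<and> f \<inter> S \<noteq> {} \<and> \<not> f \<subseteq> S \<and>
    (\<forall>e\<in>A. e \<inter> S \<noteq> {} \<longrightarrow> e \<subseteq> S \<or> e = f)")
  case True
  then show ?thesis
  proof (elim exE conjE)
    fix S f assume S: "S \<subset> C" "S \<noteq> {}" "f \<inter> S \<noteq> {}" "\<not> f \<subseteq> S"
      and only: "\<forall>e\<in>A. e \<inter> S \<noteq> {} \<longrightarrow> e \<subseteq> S \<or> e = f"
    show ?thesis
    proof (rule cubic_with_bridge[OF A C deg S])
      fix e assume "e \<in> A" "e \<inter> S \<noteq> {}" "\<not> e \<subseteq> S"
      then show "e = f" using bspec[OF only \<open>e \<in> A\<close>] by simp
    qed
  qed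
next
  case False
  have no_bridge: "\<exists>e\<in>A. e \<inter> S \<noteq> {} \<and> \<not> e \<subseteq> S \<and> e \<noteq> f"
    if S: "S \<subset> C" "S \<noteq> {}" "f \<inter> S \<noteq> {}" "\<not> f \<subseteq> S" for S f
  proof (rule ccontr)
    assume "\<not> ?thesis"
    then have only: "\<forall>e\<in>A. e \<inter> S \<noteq> {} \<longrightarrow> e \<subseteq> S \<or> e = f" by blast
    show False
      by (rule notE[OF False], rule exI[of _ S], rule exI[of _ f]) (intro conjI S only)
  qed
  show ?thesis
  proof (rule breaker_forces.breaker_forcesI)
    show "{} \<subseteq> inner A C \<and> no_copy 4 4 2 {}" by (auto simp: no_copy_def copy_on_def)
    fix f assume f: "f \<in> inner A C"
    then obtain u v where uv: "f = {u, v}" "u \<noteq> v"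
      using A(2) by (auto simp: two_sets_def inner_def card_2_iff)
    have uC: "u \<in> C" and fA: "{u, v} \<in> A" using f uv by (auto simp: inner_def)
    \<comment> \<open>Any second edge at \<open>u\<close> serves as the reply; degree three supplies
      one.\<close>
    have "\<exists>e\<in>incident A u. e \<noteq> {u, v}"
    proof (rule ccontr)
      assume "\<not> ?thesis"
      then have "incident A u \<subseteq> {{u, v}}" by blast
      from card_mono[OF _ this] show False using deg[OF uC] by simp
    qed
    then obtain e where e: "e \<in> A" "u \<in> e" "e \<noteq> {u, v}" by (auto simp: incident_def)
    then obtain w where w: "e = {u, w}" "w \<noteq> u" using A(2) two_set_cases unfolding two_sets_def by metis
    have uw: "{u, w} \<in> A" "w \<noteq> u" "w \<noteq> v" using e w by auto
    define B where "B = A - {{u, v}, {u, w}}"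
    have vC: "v \<in> C" using f uv by (auto simp: inner_def)
    have game: "breaker_forces (\<lambda>M. M \<subseteq> inner B C \<and>
      (\<forall>W\<subseteq>C. W \<noteq> {} \<longrightarrow> card (inner (insert {u, v} M) W) < card W)) {} (inner B C)"
      by (rule cubic_after_first_round[OF A C deg fA uv(2) uC uw no_bridge B_def order_refl])
        (use uC vC in simp_all)
    \<comment> \<open>A game without moves, which contributes Maker's first edge to the
      union.\<close>
    have start: "breaker_forces (\<lambda>M. M = {f}) {f} {}"
      by (rule breaker_forces.breaker_forcesI) auto
    have "breaker_forces (\<lambda>M. M \<subseteq> inner A C \<and> no_copy 4 4 2 M) ({f} \<union> {}) ({} \<union> inner B C)"
    proof (rule breaker_forces_union[OF start game])
      fix M1 M2 assume M1: "M1 = {f}" and M2: "M2 \<subseteq> inner B C \<and>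
        (\<forall>W\<subseteq>C. W \<noteq> {} \<longrightarrow> card (inner (insert {u, v} M2) W) < card W)"
      have sub: "M1 \<union> M2 \<subseteq> inner A C" using f M1 conjunct1[OF M2] by (auto simp: inner_def B_def)
      have "\<not> copy_on 4 4 2 W F" if F: "F \<subseteq> M1 \<union> M2" for W F
      proof
        assume cp: "copy_on 4 4 2 W F"
        have W: "card W = 4" using cp by (simp add: copy_on_def)
        then have "W \<noteq> {}" by auto
        moreover have "W \<subseteq> C" using copy_on_subset[OF cp order_trans[OF F sub]] by simp
        ultimately have "card (inner (insert {u, v} M2) W) < card W" using M2 by blast
        moreover have "insert {u, v} M2 = M1 \<union> M2" using M1 uv by simp
        ultimately show False using copy_on_card_le[OF cp F] W by simp
      qed
      then show "M1 \<union> M2 \<subseteq> inner A C \<and> no_copy 4 4 2 (M1 \<union> M2)" using sub by (simp add: no_copy_def)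
    qed
    then have "breaker_forces (\<lambda>M. M \<subseteq> inner A C \<and> no_copy 4 4 2 M) {f} (inner B C)" by simp
    moreover have "inner A C - {f, {u, w}} = inner B C" using uv by (auto simp: inner_def B_def)
    ultimately show "\<exists>b. breaker_forces (\<lambda>M. M \<subseteq> inner A C \<and> no_copy 4 4 2 M) (insert f {}) (inner A C - {f, b})"
      by (intro exI[of _ "{u, w}"]) simp
  qed
qed

subsection \<open>The general case\<close>

text \<open>For odd \<open>k\<close>, 2 t = k + 1 and 2 r >= n reduce \<open>le\<close> to k n <= 2
  k, so n = 2 and k = 1. For even \<open>k\<close>, 2 t = k + 2 gives k n <= n + 2 k + 2, impossible
  for k >= 4 because n >= k; for k = 2 it says r <= 3, whence n <= 2 r <= 6.\<close>

lemma equality_cases: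
  fixes k n r m t :: nat
  assumes "1 \<le> k" "k \<le> n" "2 \<le> n" "r < n" "n \<le> 2 * r" "m = k * n + r" "t = (k + 2) div 2"
    and le: "m + 1 \<le> t * (n + 2)"
  shows "(n, m, k) \<in> {(2, 3, 1), (2, 5, 2), (3, 8, 2), (4, 10, 2), (4, 11, 2), (5, 13, 2), (6, 15, 2)}"
proof (cases "odd k")
  case True
  then have "2 * t = k + 1" using assms(7) by (auto elim!: oddE)
  then have "2 * (m + 1) \<le> (k + 1) * (n + 2)" using le mult_le_mono2[OF le, of 2] by (simp add: mult.assoc[symmetric])
  then have "2 * (k * n) + 2 * r \<le> k * n + 2 * k + n" unfolding assms(6) by (simp add: algebra_simps)
  then have "k * n \<le> 2 * k" using assms(5) by linarith
  then have "n = 2" using assms(1,3) by simp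
  moreover then have "k = 1" using True assms(1,2) by (cases "k = 2") auto
  ultimately show ?thesis using assms by auto
next
  case False
  then have "2 * t = k + 2" using assms(7) by (auto elim!: evenE)
  then have *: "2 * (m + 1) \<le> (k + 2) * (n + 2)" using mult_le_mono2[OF le, of 2] by (simp add: mult.assoc[symmetric])
  have "k = 2"
  proof (rule ccontr)
    assume "k \<noteq> 2"
    then have "4 \<le> k" using False assms(1) by (cases "k = 3") auto
    then obtain j where j: "k = j + 4" by (metis add.commute le_Suc_ex)
    have "2 * (k * n) + 2 * r \<le> k * n + 2 * k + 2 * n + 2"
      using * unfolding assms(6) by (simp add: algebra_simps)
    then have "k * n \<le> n + 2 * k + 2" using assms(5) by linarith
    then have "j * n + 3 * n \<le> 2 * j + 10" unfolding j by (simp add: algebra_simps)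
    moreover have "4 \<le> n" using \<open>4 \<le> k\<close> assms(2) by simp
    moreover then have "4 * j \<le> j * n" by (simp add: mult.commute)
    ultimately show False by linarith
  qed
  then have "t = 2" "m = 2 * n + r" using assms(6,7) by auto
  then have "r \<le> 3" using le by simp
  then have "n = 2 \<and> r = 1 \<or> n = 3 \<and> r = 2 \<or> n = 4 \<and> r = 2 \<or> n = 4 \<and> r = 3 \<or> n = 5 \<and> r = 3 \<or> n = 6 \<and> r = 3"
    using assms(3,4,5) by presburger
  then show ?thesis using \<open>k = 2\<close> \<open>m = 2 * n + r\<close> by auto
qed

lemma sparse_breaker_forces:
  assumes V: "finite V" and E: "two_sets E" "E \<subseteq> Pow V"
    and n: "2 \<le> n" and k: "k = m div n" "1 \<le> k" "k \<le> n"
    and sparse: "\<And>U. U \<subseteq> V \<Longrightarrow> n * card (inner E U) \<le> m * card U"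
  shows "breaker_forces (no_copy (n + 2) (m + 1) (Suc k)) {} E"
proof -
  define r where "r = m mod n"
  have m: "m = k * n + r" and r: "r < n" using n by (auto simp: r_def k(1))
  have EV: "inner E V = E" using E(2) by (auto simp: inner_def)
  have finE: "finite E" using finite_subset[OF E(2)] V by simp
  have mlt: "m < n * Suc k" using m r by (simp add: mult.commute)
  have sparse': "card (inner E U) < Suc k * card U" if "U \<subseteq> V" "U \<noteq> {}" for U
  proof -
    have "0 < card U" using that finite_subset[OF that(1) V] by (simp add: card_gt_0_iff)
    then have "m * card U < n * Suc k * card U" using mlt by simp
    then have "n * card (inner E U) < n * (Suc k * card U)"
      using sparse[OF that(1)] by (simp only: mult.assoc)
    then show ?thesis by simp
  qed
  have core: "breaker_forces (no_copy (n + 2) (m + 1) (Suc k)) {} E"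
    if "\<And>U. finite U \<Longrightarrow> U \<subseteq> V \<Longrightarrow> U \<noteq> {} \<Longrightarrow> (\<And>x. x \<in> U \<Longrightarrow> 2 * k < card (incident (inner E U) x)) \<Longrightarrow>
      reducible E (n + 2) (m + 1) (Suc k) U"
    using core_reduction[OF E(1) V, of "m + 1" k "n + 2"] that finite_subset[OF _ V] unfolding EV by simp
  show ?thesis
  proof (cases "2 * r < n")
    case True
    show ?thesis
    proof (rule core)
      fix U assume U: "finite U" "U \<subseteq> V" "U \<noteq> {}" and deg: "\<And>x. x \<in> U \<Longrightarrow> 2 * k < card (incident (inner E U) x)"
      \<comment> \<open>Here no core survives: its average degree would be at least 2k + 1, but it
        is at most 2 m / n, which is smaller as 2 r < n.\<close>
      have "(\<Sum>x\<in>U. 2 * k + 1) \<le> (\<Sum>x\<in>U. card (incident (inner E U) x))"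
        using deg by (intro sum_mono) (simp add: Suc_leI)
      then have "(2 * k + 1) * card U \<le> 2 * card (inner E U)"
        using handshake[OF U(1) E(1)] by (simp add: mult.commute)
      then have "n * ((2 * k + 1) * card U) \<le> 2 * (n * card (inner E U))"
        using mult_le_mono2[of _ _ n] by (metis mult.left_commute)
      also have "\<dots> \<le> 2 * (m * card U)" using sparse[OF U(2)] by simp
      finally have "(n * (2 * k + 1)) * card U \<le> (2 * m) * card U" by (simp only: mult.assoc)
      moreover have "0 < card U" using U by (simp add: card_gt_0_iff)
      ultimately have "n * (2 * k + 1) \<le> 2 * m" by simp
      then have False using True m by (simp add: algebra_simps)
      then show "reducible E (n + 2) (m + 1) (Suc k) U" ..
    qed
  next
    case False
    \<comment> \<open>This is (k + 1)/2 rounded up, Maker's share of k + 1 owned edges.\<close>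
    define t where "t = (k + 2) div 2"
    show ?thesis
    proof (cases "t * (n + 2) < m + 1")
      case True
      have "card (inner E U) \<le> Suc k * card U" if "U \<subseteq> V" for U
      proof (cases "U = {}")
        case True
        then have "inner E U = {}" using E(1) by (auto simp: inner_def two_sets_def)
        then show ?thesis by simp
      qed (use sparse'[OF that] in simp)
      from sparse_orientation[OF V E this] obtain ow
        where ow: "\<And>e. e \<in> E \<Longrightarrow> ow e \<in> e" "\<And>x. card {e\<in>E. ow e = x} \<le> Suc k"
        by blast
      have "Suc k \<le> 2 * t" unfolding t_def by linarith
      then have "card {e\<in>E. ow e = x} \<le> 2 * t" for x using ow(2)[of x] by linarith
      from breaker_forces_oriented[OF finE ow(1) this True] show ?thesis .
    next
      case nt: False
      have "(n, m, k) \<in> {(2, 3, 1), (2, 5, 2), (3, 8, 2), (4, 10, 2), (4, 11, 2), (5, 13, 2), (6, 15, 2)}"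
        using equality_cases[OF k(2,3) n r _ m t_def] False nt by simp
      \<comment> \<open>The triples (4, 11, 2), (5, 13, 2) and (6, 15, 2) are those with e_H = 2 v_H
        and share the case \<open>twice\<close>.\<close>
      then consider (C4) "n = 2" "m = 3" "k = 1" | (K4) "n = 2" "m = 5" "k = 2"
        | (five_nine) "n = 3" "m = 8" "k = 2" | (six_eleven) "n = 4" "m = 10" "k = 2"
        | (twice) "m + 1 = 2 * (n + 2)" "k = 2" by auto
      then show ?thesis
      proof cases
        case C4
        show ?thesis
        proof (rule core)
          fix U assume U: "finite U" "U \<subseteq> V" "U \<noteq> {}" and deg: "\<And>x. x \<in> U \<Longrightarrow> 2 * k < card (incident (inner E U) x)"
          have "3 \<le> card (incident (inner E U) x)" if "x \<in> U" for x using deg[OF that] C4 by simp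
          moreover have "2 * card (inner E U) \<le> 3 * card U" using sparse[OF U(2)] C4 by simp
          ultimately have "\<exists>C\<subseteq>U. component (inner E U) C \<and> (\<forall>x\<in>C. card (incident (inner E U) x) = 3)"
            by (rule regular_component[OF U(1,3) E(1)])
          then obtain C where C: "C \<subseteq> U" "component (inner E U) C"
            and reg: "\<And>x. x \<in> C \<Longrightarrow> card (incident (inner E U) x) = 3"
            by blast
          have "inner (inner E U) C = inner E C" using C(1) by (auto simp: inner_def)
          moreover note cubic_4_4[OF finite_inner[OF U(1)] two_sets_inner[OF E(1)] finite_subset[OF C(1) U(1)] C(2) reg]
          ultimately have game: "breaker_forces (\<lambda>M. M \<subseteq> inner E C \<and> no_copy 4 4 2 M) {} (inner E C)" by simp
          show "reducible E (n + 2) (m + 1) (Suc k) U"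
            by (rule component_reducible[OF E(1) C]) (use game in \<open>simp_all add: C4 del: One_nat_def\<close>)
        qed
      next
        case K4
        show ?thesis
        proof (rule core)
          fix U assume U: "finite U" "U \<subseteq> V" "U \<noteq> {}" and deg: "\<And>x. x \<in> U \<Longrightarrow> 2 * k < card (incident (inner E U) x)"
          have "5 \<le> card (incident (inner E U) x)" if "x \<in> U" for x using deg[OF that] K4 by simp
          moreover have "2 * card (inner E U) \<le> 5 * card U" using sparse[OF U(2)] K4 by simp
          ultimately have "\<exists>C\<subseteq>U. component (inner E U) C \<and> (\<forall>x\<in>C. card (incident (inner E U) x) = 5)"
            by (rule regular_component[OF U(1,3) E(1)])
          then obtain C where C: "C \<subseteq> U" "component (inner E U) C"
            and reg: "\<And>x. x \<in> C \<Longrightarrow> card (incident (inner E U) x) = 5"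
            by blast
          note game = five_regular_4_6[OF E(1) U(1) C reg]
          show "reducible E (n + 2) (m + 1) (Suc k) U"
            by (rule component_reducible[OF E(1) C]) (use game in \<open>simp_all add: K4 del: One_nat_def\<close>)
        qed
      next
        case six_eleven
        show ?thesis
        proof (rule core)
          fix U assume U: "finite U" "U \<subseteq> V" "U \<noteq> {}" and deg: "\<And>x. x \<in> U \<Longrightarrow> 2 * k < card (incident (inner E U) x)"
          have "5 \<le> card (incident (inner E U) x)" if "x \<in> U" for x using deg[OF that] six_eleven by simp
          moreover have "2 * card (inner E U) \<le> 5 * card U" using sparse[OF U(2)] six_eleven by simp
          ultimately have "\<exists>C\<subseteq>U. component (inner E U) C \<and> (\<forall>x\<in>C. card (incident (inner E U) x) = 5)"
            by (rule regular_component[OF U(1,3) E(1)])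
          then obtain C where C: "C \<subseteq> U" "component (inner E U) C"
            and reg: "\<And>x. x \<in> C \<Longrightarrow> card (incident (inner E U) x) = 5"
            by blast
          note game = five_regular_6_11[OF E(1) U(1) C reg]
          show "reducible E (n + 2) (m + 1) (Suc k) U"
            by (rule component_reducible[OF E(1) C]) (use game in \<open>simp_all add: six_eleven del: One_nat_def\<close>)
        qed
      next
        case five_nine
        show ?thesis
        proof (rule core)
          fix U assume U: "finite U" "U \<subseteq> V" "U \<noteq> {}" and deg: "\<And>x. x \<in> U \<Longrightarrow> 2 * k < card (incident (inner E U) x)"
          have "5 \<le> card (incident (inner E U) x)" if "x \<in> U" for x using deg[OF that] five_nine by simp
          moreover have "3 * card (inner E U) \<le> 8 * card U" using sparse[OF U(2)] five_nine by simp
          ultimately obtain x y where "x \<in> U" "y \<in> U" "x \<noteq> y" "{x, y} \<in> E"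
            "card (incident (inner E U) x) = 5" "card (incident (inner E U) y) = 5"
            using adjacent_degree_five[OF U(1,3) E(1)] by blast
          from adjacent_degree_five_reducible[OF U(1) E(1) this]
          show "reducible E (n + 2) (m + 1) (Suc k) U"
            by (simp add: five_nine)
        qed
      next
        case twice
        have "card (inner E U) < 3 * card U" if "U \<subseteq> V" "U \<noteq> {}" for U
          using sparse'[OF that] twice(2) by simp
        from breaker_forces_oriented_three[OF V E this, of "n + 2" "Suc k"] show ?thesis
          using twice(1) by simp
      qed
    qed
  qed
qed

section \<open>Translating the densities of \<open>G\<close> and \<open>H\<close>\<close>

lemma inner_graph:
  assumes "graph G"
  shows "two_sets (edges G)" "edges G \<subseteq> Pow (verts G)" "finite (verts G)" "finite (edges G)"
    "inner (edges G) (verts G) = edges G"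
proof -
  show *: "two_sets (edges G)" "edges G \<subseteq> Pow (verts G)" "finite (verts G)" "inner (edges G) (verts G) = edges G"
    using assms by (auto simp: graph_def two_sets_def inner_def)
  then show "finite (edges G)" by (meson finite_Pow_iff finite_subset)
qed

lemma max_density_ge:
  assumes G: "graph G" and U: "U \<subseteq> verts G" "U \<noteq> {}"
  shows "real (card (inner (edges G) U)) / real (card U) \<le> max_density G"
proof -
  let ?S = "{real (card (edges J)) / real (card (verts J)) | J. subgraph J G \<and> verts J \<noteq> {}}"
  have "?S \<subseteq> (\<lambda>J. real (card (edges J)) / real (card (verts J))) ` (Pow (verts G) \<times> Pow (edges G))"
  proof
    fix x assume "x \<in> ?S"
    then obtain J where "x = real (card (edges J)) / real (card (verts J))" "subgraph J G" by blast
    then show "x \<in> (\<lambda>J. real (card (edges J)) / real (card (verts J))) ` (Pow (verts G) \<times> Pow (edges G))"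
      by (intro image_eqI[of _ _ J]) (auto simp: subgraph_def mem_Times_iff)
  qed
  then have "finite ?S" by (rule finite_subset) (use inner_graph[OF G] in simp)
  moreover have "subgraph (U, inner (edges G) U) G"
    using G U finite_subset[OF U(1)] by (auto simp: subgraph_def graph_def inner_def)
  then have "real (card (inner (edges G) U)) / real (card U) \<in> ?S"
    using U(2) by (intro CollectI exI[of _ "(U, inner (edges G) U)"]) simp
  ultimately show ?thesis unfolding max_density_def by (rule Max_ge)
qed

text \<open>Deleting \<open>w\<close>, of degree d, must lower the 2-density: (m - d)/(n - 1) < m/n,
  which rearranges to m < d n. Strictness makes d at least k + 1 even when n divides m.\<close>

lemma strictly_2_balanced_min_degree:
  assumes H: "graph H" "strictly_2_balanced H" "4 \<le> card (verts H)" and w: "w \<in> verts H"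
  shows "real (card (edges H)) - 1 < real (card (incident (edges H) w)) * (real (card (verts H)) - 2)"
proof -
  let ?J = "(verts H - {w}, edges H - incident (edges H) w)"
  have fin: "finite (verts H)" "finite (edges H)" using inner_graph[OF H(1)] by auto
  have "subgraph ?J H" using H(1) by (auto simp: subgraph_def graph_def incident_def)
  moreover have "?J \<noteq> H" using w by (metis DiffD2 fst_conv insertI1)
  moreover have cv: "card (verts ?J) = card (verts H) - 1" using w fin by simp
  then have "3 \<le> card (verts ?J)" using H(3) by simp
  ultimately have lt: "d2 ?J < d2 H" using H(2) by (auto simp: strictly_2_balanced_def)
  have sub: "incident (edges H) w \<subseteq> edges H" by (auto simp: incident_def)
  have "card (edges ?J) = card (edges H) - card (incident (edges H) w)"
    using card_Diff_subset[OF finite_incident[OF fin(2)] sub] by simp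
  moreover have "card (incident (edges H) w) \<le> card (edges H)" using card_mono[OF fin(2) sub] .
  ultimately have eJ: "real (card (edges ?J)) = real (card (edges H)) - real (card (incident (edges H) w))"
    by (simp add: of_nat_diff)
  have vJ: "real (card (verts ?J)) = real (card (verts H)) - 1" using cv H(3) by simp
  have "d2 ?J = (real (card (edges H)) - real (card (incident (edges H) w)) - 1) / (real (card (verts H)) - 3)"
    unfolding d2_def eJ vJ by simp
  then have "(real (card (edges H)) - real (card (incident (edges H) w)) - 1) / (real (card (verts H)) - 3)
      < (real (card (edges H)) - 1) / (real (card (verts H)) - 2)"
    using lt by (simp only: d2_def[of H])
  moreover have "real (card (verts H)) - 3 > 0" "real (card (verts H)) - 2 > 0" using H(3) by auto
  ultimately have "(real (card (edges H)) - real (card (incident (edges H) w)) - 1) * (real (card (verts H)) - 2)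
      < (real (card (edges H)) - 1) * (real (card (verts H)) - 3)"
    by (simp add: divide_less_eq less_divide_eq mult.commute split: if_splits)
  then show ?thesis by (simp add: algebra_simps)
qed

text \<open>A path with two edges has \<open>d\<^sub>2 = 1\<close>, so a strictly 2-balanced graph with smaller
  \<open>d\<^sub>2\<close> is a matching, and two of its edges already have \<open>d\<^sub>2 = 1/2\<close>.\<close>
lemma strictly_2_balanced_d2_ge_1:
  assumes H: "graph H" "strictly_2_balanced H" "4 \<le> card (verts H)" "\<not> two_disjoint_edges H"
    and e: "1 \<le> card (edges H)"
  shows "card (verts H) - 2 \<le> card (edges H) - 1"
proof (rule ccontr)
  assume neg: "\<not> ?thesis"
  have bal: "\<And>J. subgraph J H \<Longrightarrow> J \<noteq> H \<Longrightarrow> 3 \<le> card (verts J) \<Longrightarrow> d2 J < d2 H"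
    using H(2) unfolding strictly_2_balanced_def by metis
  note ig = inner_graph[OF H(1)]
  have n: "real (card (verts H)) - 2 > 0" using H(3) by simp
  have lt1: "d2 H < 1" using neg n e H(3) by (simp add: d2_def divide_less_eq)
  have sub: "subgraph (\<Union>F, F) H" if "F \<subseteq> edges H" for F
    using H(1) that finite_subset[of "\<Union>F" "verts H"] by (fastforce simp: subgraph_def graph_def)
  have disj: "e1 \<inter> e2 = {}" if ed: "e1 \<in> edges H" "e2 \<in> edges H" "e1 \<noteq> e2" for e1 e2
  proof (rule ccontr)
    assume "e1 \<inter> e2 \<noteq> {}"
    then obtain a where a: "a \<in> e1" "a \<in> e2" by blast
    have "card e1 = 2" "card e2 = 2" using ed ig(1) by (auto simp: two_sets_def)
    then obtain b c where b: "e1 = {a, b}" "b \<noteq> a" and c: "e2 = {a, c}" "c \<noteq> a"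
      using a by (meson two_set_cases)
    have "b \<noteq> c" using b c ed by auto
    have "\<Union>{e1, e2} = {a, b, c}" using b c by auto
    then have c3: "card (\<Union>{e1, e2}) = 3" using b c \<open>b \<noteq> c\<close> by simp
    have "d2 (\<Union>{e1, e2}, {e1, e2}) < d2 H"
    proof (rule bal)
      show "subgraph (\<Union>{e1, e2}, {e1, e2}) H" using ed by (intro sub) auto
      show "(\<Union>{e1, e2}, {e1, e2}) \<noteq> H" using c3 H(3) by auto
    qed (use c3 in simp)
    then show False using c3 ed(3) lt1 by (simp add: d2_def)
  qed
  have deg: "card (incident (edges H) w) = 1" if w: "w \<in> verts H" for w
  proof -
    have "0 \<le> real (card (edges H)) - 1" using e by simp
    then have "0 < real (card (incident (edges H) w)) * (real (card (verts H)) - 2)"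
      using strictly_2_balanced_min_degree[OF H(1-3) w] by linarith
    then have "0 < card (incident (edges H) w)" using n by (simp add: zero_less_mult_iff)
    then obtain x where x: "x \<in> incident (edges H) w" by (auto simp: card_gt_0_iff)
    have "incident (edges H) w = {x}" using x disj by (auto simp: incident_def)
    then show ?thesis by simp
  qed
  have twice: "card (verts H) = 2 * card (edges H)"
    using handshake[OF ig(3,1)] ig(5) deg by simp
  then have "2 \<le> card (edges H)" using H(3) by simp
  then obtain F where F: "F \<subseteq> edges H" "card F = 2" by (meson obtain_subset_with_card_n)
  then obtain e1 e2 where e12: "F = {e1, e2}" "e1 \<noteq> e2" by (auto simp: card_2_iff)
  have "card e1 = 2" "card e2 = 2" using F e12 ig(1) by (auto simp: two_sets_def)
  then obtain a b c d where abcd: "e1 = {a, b}" "a \<noteq> b" "e2 = {c, d}" "c \<noteq> d" by (auto simp: card_2_iff)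
  have "e1 \<inter> e2 = {}" using disj e12 F by auto
  then have dist: "distinct [a, b, c, d]" using abcd by auto
  have UF: "\<Union>F = {a, b, c, d}" using e12 abcd by auto
  then have c4: "card (\<Union>F) = 4" using dist by simp
  have "d2 (\<Union>F, F) = 1 / 2" using c4 F(2) by (simp add: d2_def)
  \<comment> \<open>All degrees are one, so v = 2 e and (e - 1)/(2 e - 2) = 1/2. Two edges already
    attain this value, so they cannot form a proper subgraph.\<close>
  moreover have "d2 H = 1 / 2" using twice n by (simp add: d2_def field_simps)
  ultimately have "(\<Union>F, F) = H" using bal[OF sub[OF F(1)]] c4 by auto
  then have "H = ({a, b, c, d}, {{a, b}, {c, d}})" using UF e12 abcd by auto
  then show False using H(4) dist unfolding two_disjoint_edges_def by blast
qed

lemma contains_copy_imp_copy_on: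
  assumes H: "graph H" and copy: "contains_copy (V, M) H"
    and deg: "\<And>w. w \<in> verts H \<Longrightarrow> d \<le> card (incident (edges H) w)"
  obtains W F where "F \<subseteq> M" "copy_on (card (verts H)) (card (edges H)) d W F"
proof -
  obtain f where f: "inj_on f (verts H)" "\<And>e. e \<in> edges H \<Longrightarrow> f ` e \<in> M"
    using copy by (auto simp: contains_copy_def)
  note ig = inner_graph[OF H]
  have inj: "inj_on (image f) (edges H)"
    using inj_on_subset[OF inj_on_image_Pow[OF f(1)] ig(2)] .
  have "copy_on (card (verts H)) (card (edges H)) d (f ` verts H) (image f ` edges H)"
    unfolding copy_on_def
  proof (intro conjI ballI)
    show "finite (f ` verts H)" using ig by simp
    show "card (f ` verts H) = card (verts H)" using f(1) by (rule card_image)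
    show "card (image f ` edges H) = card (edges H)" using inj by (rule card_image)
    show "e \<subseteq> f ` verts H" if "e \<in> image f ` edges H" for e using that ig(2) by auto
    fix y assume "y \<in> f ` verts H"
    then obtain w where w: "w \<in> verts H" "y = f w" by blast
    have "incident (image f ` edges H) y = image f ` incident (edges H) w"
    proof -
      have "y \<in> f ` e \<longleftrightarrow> w \<in> e" if "e \<in> edges H" for e
      proof -
        have "e \<subseteq> verts H" using that ig(2) by auto
        then show ?thesis using inj_on_image_mem_iff[OF f(1) w(1)] w(2) by simp
      qed
      then show ?thesis unfolding incident_def by blast
    qed
    moreover have "card (image f ` incident (edges H) w) = card (incident (edges H) w)"
      by (rule card_image[OF inj_on_subset[OF inj]]) (auto simp: incident_def)
    ultimately show "d \<le> card (incident (image f ` edges H) y)" using deg[OF w(1)] by simp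
  qed
  moreover have "image f ` edges H \<subseteq> M" using f(2) by auto
  ultimately show ?thesis using that by blast
qed

theorem theorem18:
  fixes G :: "'a ugraph" and H :: "'b ugraph"
  assumes "graph G" and "graph H"
    and "max_density G \<le> m2 H"
    and "strictly_2_balanced H"
    and "card (verts H) \<ge> 4"
    and "\<not> two_disjoint_edges H"
  shows "breaker_wins_game H G"
proof -
  note igG = inner_graph[OF assms(1)] and igH = inner_graph[OF assms(2)]
  have "breaker_forces (\<lambda>M. \<not> contains_copy (verts G, M) H) {} (edges G)"
  \<comment> \<open>Without vertices \<open>max_density\<close> is unspecified, but then
    \<open>G\<close> has no room for a copy.\<close>
  proof (cases "verts G = {}")
    case True
    then have "\<not> contains_copy (verts G, M) H" for M
      using assms(5) by (auto simp: contains_copy_def)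
    then show ?thesis by (intro breaker_forces_mono[OF breaker_forces_any[OF igG(4)]])
  next
    case False
    define n where "n = card (verts H) - 2"
    define m where "m = card (edges H) - 1"
    define k where "k = m div n"
    have dens: "real (card (inner (edges G) U)) / real (card U) \<le> d2 H" if "U \<subseteq> verts G" "U \<noteq> {}" for U
      using max_density_ge[OF assms(1) that] assms(3,4) by (simp add: strictly_2_balanced_def)
    have v2: "real (card (verts H)) - 2 = real n" "2 \<le> n" "card (verts H) = n + 2"
      using assms(5) by (auto simp: n_def)
    \<comment> \<open>Densities of \<open>G\<close> are nonnegative, so \<open>H\<close> has an edge
      and the truncated subtraction in \<open>m\<close> is exact.\<close>
    have "0 \<le> d2 H" using dens[OF order_refl False] by (meson divide_nonneg_nonneg of_nat_0_le_iff order_trans)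
    then have "1 \<le> real (card (edges H))" using v2 by (auto simp: d2_def zero_le_divide_iff)
    then have e1: "1 \<le> card (edges H)" by simp
    then have e2: "real (card (edges H)) - 1 = real m" "card (edges H) = m + 1" by (auto simp: m_def)
    have d2H: "d2 H = real m / real n" by (simp add: d2_def v2(1) e2(1))
    have "n \<le> m" using strictly_2_balanced_d2_ge_1[OF assms(2,4,5,6) e1] by (simp add: n_def m_def)
    then have k1: "1 \<le> k" using v2(2) by (simp add: k_def Suc_le_eq div_greater_zero_iff)
    have deg: "Suc k \<le> card (incident (edges H) w)" if "w \<in> verts H" for w
    proof -
      have "real m < real (card (incident (edges H) w)) * real n"
        using strictly_2_balanced_min_degree[OF assms(2,4,5) that] by (simp only: v2(1) e2(1))
      then have "m < card (incident (edges H) w) * n" by (metis of_nat_less_iff of_nat_mult)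
      then have "k < card (incident (edges H) w)" unfolding k_def by (rule less_mult_imp_div_less)
      then show ?thesis by simp
    qed
    obtain w where w: "w \<in> verts H" using assms(5) by fastforce
    \<comment> \<open>Degrees in a simple graph are below v_H = n + 2, which bounds \<open>k\<close>
      by \<open>n\<close>; the finite case list rests on this bound.\<close>
    have "card (incident (edges H) w) < card (verts H)"
      using card_incident_less[OF igH(1,3) w] igH(5) by simp
    then have kn: "k \<le> n" using deg[OF w] v2(3) by simp
    have sparse: "n * card (inner (edges G) U) \<le> m * card U" if "U \<subseteq> verts G" for U
    proof (cases "U = {}")
      case True
      then have "inner (edges G) U = {}" using igG(1) by (auto simp: inner_def two_sets_def)
      then show ?thesis by simp
    next
      case False
      have "0 < card U" using False finite_subset[OF that igG(3)] by (simp add: card_gt_0_iff)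
      then have "real (card (inner (edges G) U)) * real n \<le> real m * real (card U)"
        using dens[OF that False] v2(2) by (simp add: d2H field_simps)
      then have "real (n * card (inner (edges G) U)) \<le> real (m * card U)" by (simp add: mult.commute)
      then show ?thesis by (simp only: of_nat_le_iff)
    qed
    have "breaker_forces (no_copy (n + 2) (m + 1) (Suc k)) {} (edges G)"
      by (rule sparse_breaker_forces[OF igG(3,1,2) v2(2) k_def k1 kn sparse])
    then show ?thesis
    proof (rule breaker_forces_mono, intro notI)
      fix M assume M: "no_copy (n + 2) (m + 1) (Suc k) M" and "contains_copy (verts G, M) H"
      from contains_copy_imp_copy_on[OF assms(2) this(2) deg] obtain W F
        where "F \<subseteq> M" "copy_on (card (verts H)) (card (edges H)) (Suc k) W F" .
      then show False using M v2(3) e2(2) by (simp add: no_copy_def)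
    qed
  qed
  then show ?thesis
  proof (rule breaker_forces_imp_strategy[OF igG(4)])
    fix \<sigma> assume "breaker_strategy G \<sigma>"
      "\<And>p. complete_play G p \<Longrightarrow> follows \<sigma> p \<Longrightarrow> \<not> contains_copy (verts G, maker_edges p) H"
    then show ?thesis by (auto simp: breaker_wins_game_def maker_wins_play_def)
  qed
qed

end
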